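(* Let $(X,d)$ be a compact metric space and let $(X,\phi)$ be a flow on $X$ without fixed points. If $K$ is a non-empty compact subset of $X$, then $$h_{\mathrm{top}}^{P}(\phi,K)=\sup\{\overline{h}_{\mu}(\phi):\mu\in M(X),\ \mu(K)=1\},$$ where $h_{\mathrm{top}}^{P}(\phi,K)$ is the packing topological entropy of $\phi$ on $K$ defined via reparametrization balls, $M(X)$ is the set of Borel probability measures on $X$, and $\overline{h}_{\mu}(\phi)$ is the measure-theoretic upper local entropy of $\mu$.
   Context: Flow: $(X,d)$ is a compact metric space and $\phi:X\times\mathbb{R}\to X$ is continuous with $\phi_t\circ\phi_s=\phi_{s+t}$ for all $s,t\in\mathbb{R}$, each $\phi_t=\phi(\cdot,t)$ being a homeomorphism of $X$. The flow has no fixed points if there is no $x\in X$ with $\phi_t(x)=x$ for all $t\in\mathbb{R}$. $M(X)$ denotes the set of all (not necessarily invariant) Borel probability measures on $X$. Reparametrizations: for a closed interval $I$ containing $0$, $Rep(I)$ is the set of continuous maps $\alpha:I\to\mathbb{R}$ that are homeomorphisms onto their image and satisfy $\alpha(0)=0$. Reparametrization balls: for $x\in X$, $t>0$, $\varepsilon>0$, $$B(x,t,\varepsilon,\phi)=\{y\in X:\exists\,\alpha\in Rep([0,t])\text{ with } d(\phi_{\alpha(s)}x,\phi_s y)<\varepsilon\ \text{for all } 0\le s\le t\},$$ and $\overline{B}(x,t,\varepsilon,\phi)$ is defined in the same way with $<\varepsilon$ replaced by $\le\varepsilon$. Packing topological entropy: for $Z\subset X$, $s\ge 0$, $N\in\mathbb{N}$,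 $\varepsilon>0$, let $$P_{N,\varepsilon}^{s}(\phi,Z)=\sup\sum_i \exp(-st_i),$$ the supremum being over all finite or countable families of pairwise disjoint closed reparametrization balls $\{\overline{B}(x_i,t_i,\varepsilon,\phi)\}$ with $x_i\in Z$ and $t_i\ge N$ ($t_i$ real). Let $P_{\varepsilon}^{s}(\phi,Z)=\lim_{N\to\infty}P_{N,\varepsilon}^{s}(\phi,Z)$ (non-increasing in $N$), and $$\mathcal{P}_{\varepsilon}^{s}(Z)=\inf\Big\{\sum_{i=1}^\infty P_{\varepsilon}^{s}(\phi,Z_i): Z\subset\bigcup_{i=1}^\infty Z_i\Big\}.$$ Put $h_{\mathrm{top}}^P(\phi,Z,\varepsilon)=\inf\{s\ge 0:\mathcal{P}_{\varepsilon}^s(Z)=0\}=\sup\{s\ge 0:\mathcal{P}_{\varepsilon}^s(Z)=+\infty\}$ (with $\inf\emptyset=+\infty$, $\sup\emptyset=0$), which does not decrease as $\varepsilon$ decreases, and $h_{\mathrm{top}}^P(\phi,Z)=\lim_{\varepsilon\to 0}h_{\mathrm{top}}^P(\phi,Z,\varepsilon)\in[0,+\infty]$. Upper local entropy: for $\mu\in M(X)$ and $x\in X$, $$\overline{h}_{\mu}(\phi,x)=\lim_{\varepsilon\to 0}\limsup_{t\to+\infty}-\frac1t\log\mu(B(x,t,\varepsilon,\phi))$$ (with $-\log 0=+\infty$), and $\overline{h}_{\mu}(\phi)=\int\overline{h}_{\mu}(\phi,x)\,d\mu(x)$. *)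

theory Defs
  imports "HOL-Probability.Probability"
begin

definition flow :: "(real \<Rightarrow> 'a::metric_space \<Rightarrow> 'a) \<Rightarrow> bool" where
  "flow \<phi> \<longleftrightarrow>
     continuous_on UNIV (\<lambda>(x, t). \<phi> t x) \<and>
     (\<forall>s t. \<phi> t \<circ> \<phi> s = \<phi> (s + t)) \<and>
     (\<forall>t. \<exists>\<psi>. homeomorphism UNIV UNIV (\<phi> t) \<psi>)"

definition no_fixed_points :: "(real \<Rightarrow> 'a \<Rightarrow> 'a) \<Rightarrow> bool" where
  "no_fixed_points \<phi> \<longleftrightarrow> \<not> (\<exists>x. \<forall>t. \<phi> t x = x)"

(* Reparametrizations need not be increasing. Functions on I are total functions
   here; only their values on I matter. *)
definition Rep :: "real set \<Rightarrow> (real \<Rightarrow> real) set" where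
  "Rep I = {\<alpha>. continuous_on I \<alpha> \<and> (\<exists>\<beta>. homeomorphism I (\<alpha> ` I) \<alpha> \<beta>) \<and> \<alpha> 0 = 0}"

definition rball ::
    "(real \<Rightarrow> 'a::metric_space \<Rightarrow> 'a) \<Rightarrow> 'a \<Rightarrow> real \<Rightarrow> real \<Rightarrow> 'a set" where
  "rball \<phi> x t \<epsilon> = {y. \<exists>\<alpha>\<in>Rep {0..t}. \<forall>s\<in>{0..t}. dist (\<phi> (\<alpha> s) x) (\<phi> s y) < \<epsilon>}"

definition rcball ::
    "(real \<Rightarrow> 'a::metric_space \<Rightarrow> 'a) \<Rightarrow> 'a \<Rightarrow> real \<Rightarrow> real \<Rightarrow> 'a set" where
  "rcball \<phi> x t \<epsilon> = {y. \<exists>\<alpha>\<in>Rep {0..t}. \<forall>s\<in>{0..t}. dist (\<phi> (\<alpha> s) x) (\<phi> s y) \<le> \<epsilon>}"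

(* A finite or countable family is indexed by an arbitrary set I of naturals.
   The condition t i > 0 matters only for N = 0, since balls are only considered
   for positive times. *)
definition packing_pre ::
    "(real \<Rightarrow> 'a::metric_space \<Rightarrow> 'a) \<Rightarrow> real \<Rightarrow> real \<Rightarrow> nat \<Rightarrow> 'a set \<Rightarrow> ennreal" where
  "packing_pre \<phi> s \<epsilon> N Z =
     Sup {\<Sum>\<^sub>\<infinity>i\<in>I. ennreal (exp (- s * t i)) | (I :: nat set) (x :: nat \<Rightarrow> 'a) (t :: nat \<Rightarrow> real).
            (\<forall>i\<in>I. x i \<in> Z \<and> t i > 0 \<and> t i \<ge> real N) \<and>
            disjoint_family_on (\<lambda>i. rcball \<phi> (x i) (t i) \<epsilon>) I}"

(* All limits below are limits of monotone functions into the complete linear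
   order [0, \<infinity>], so Lim denotes an actual limit. *)
definition packing_lim ::
    "(real \<Rightarrow> 'a::metric_space \<Rightarrow> 'a) \<Rightarrow> real \<Rightarrow> real \<Rightarrow> 'a set \<Rightarrow> ennreal" where
  "packing_lim \<phi> s \<epsilon> Z = lim (\<lambda>N. packing_pre \<phi> s \<epsilon> N Z)"

definition packing_measure ::
    "(real \<Rightarrow> 'a::metric_space \<Rightarrow> 'a) \<Rightarrow> real \<Rightarrow> real \<Rightarrow> 'a set \<Rightarrow> ennreal" where
  "packing_measure \<phi> s \<epsilon> Z =
     Inf {\<Sum>i. packing_lim \<phi> s \<epsilon> (Zs i) | Zs :: nat \<Rightarrow> 'a set. Z \<subseteq> (\<Union>i. Zs i)}"

definition packing_entropy_at ::
    "(real \<Rightarrow> 'a::metric_space \<Rightarrow> 'a) \<Rightarrow> 'a set \<Rightarrow> real \<Rightarrow> ennreal" where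
  "packing_entropy_at \<phi> Z \<epsilon> = Inf {ennreal s | s. s \<ge> 0 \<and> packing_measure \<phi> s \<epsilon> Z = 0}"

definition packing_entropy ::
    "(real \<Rightarrow> 'a::metric_space \<Rightarrow> 'a) \<Rightarrow> 'a set \<Rightarrow> ennreal" where
  "packing_entropy \<phi> Z = Lim (at_right 0) (\<lambda>\<epsilon>. packing_entropy_at \<phi> Z \<epsilon>)"

definition borel_prob_measures :: "'a::topological_space measure set" where
  "borel_prob_measures = {\<mu>. prob_space \<mu> \<and> sets \<mu> = sets borel}"

(* - log m for m in [0,1], with - log 0 = \<infinity>; no truncation occurs since ln m \<le> 0. *)
definition neg_log :: "real \<Rightarrow> ennreal" where
  "neg_log m = (if m = 0 then \<infinity> else ennreal (- ln m))"

definition upper_local_entropy_at ::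
    "(real \<Rightarrow> 'a::metric_space \<Rightarrow> 'a) \<Rightarrow> 'a measure \<Rightarrow> 'a \<Rightarrow> ennreal" where
  "upper_local_entropy_at \<phi> \<mu> x =
     Lim (at_right 0) (\<lambda>\<epsilon>.
       Limsup at_top (\<lambda>t. neg_log (measure \<mu> (rball \<phi> x t \<epsilon>)) / ennreal t))"

definition upper_local_entropy ::
    "(real \<Rightarrow> 'a::metric_space \<Rightarrow> 'a) \<Rightarrow> 'a measure \<Rightarrow> ennreal" where
  "upper_local_entropy \<phi> \<mu> = (\<integral>\<^sup>+ x. upper_local_entropy_at \<phi> \<mu> x \<partial>\<mu>)"

end

theory Submission
  imports Defs
begin

text \<open>
  Without fixed points, small displacements \<open>\<phi>\<^bsub>\<tau>\<^esub>\<close> move every point by a definite amount. Hence a time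
  change that keeps two orbits close runs at nearly unit speed, and reparametrization balls of
  small radius satisfy a triangle inequality up to a factor of time arbitrarily close to \<open>1\<close>.

  If \<open>s\<close> exceeds the packing entropy of \<open>K\<close>, the points whose ball of time \<open>n\<close> has mass below
  \<open>exp (- s n)\<close> are covered by the balls around a maximal packing; summing over \<open>n\<close> bounds the mass of
  the points for which this happens infinitely often by a multiple of the packing measure, which is \<open>0\<close>.

  Conversely, for \<open>s\<close> below the packing entropy, the points of \<open>K\<close> that have no null neighborhood
  form a set containing, near each of its points, packings of arbitrarily large mass. Choosing them
  successively at smaller scales yields a tree of points of \<open>K\<close>, and distributing the unit mass along
  the tree in proportion to \<open>exp (- s t)\<close> gives a measure of local entropy at least \<open>s\<close>. The levels
  of the tree are realized as step functions on \<open>[0,1]\<close> converging uniformly, and the measure is the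
  image of Lebesgue measure under the limit.
\<close>

section \<open>Reparametrization balls in fixed-point-free flows\<close>

text \<open>The local entropy is not shown to be measurable, so its integral is handled from below:
  as a supremum over simple functions for the upper bound, and against a constant multiple of an
  indicator for the lower bound. For the same reason, sets of points with small balls are enclosed
  in open sets instead of being measured. Comparing a closed ball of time
  \<open>\<kappa> * r\<close> with an open ball of time \<open>r\<close> multiplies exponents by
  \<open>\<kappa>\<close>; every such loss is paid from a strict gap between exponents. In the tree,
  only the cap \<open>exp (- s * t)\<close> on the mass of a node of time \<open>t\<close> matters.
  Since packings of infinite weight leave room, the mass is poured greedily into the nodes up to
  their caps, and exact proportions are not kept. Each level controls the ball around a limit point
  at one time only, which may differ from node to node. A limsup over times asks for no more, and
  this is why packings with variable times match the upper local entropy.\<close>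

lemma Rep_atLeastAtMost:
  "\<alpha> \<in> Rep {0..t} \<longleftrightarrow> continuous_on {0..t} \<alpha> \<and> inj_on \<alpha> {0..t} \<and> \<alpha> 0 = 0"
proof -
  \<comment> \<open>The interval is compact, so the inverse of a continuous injection is
    automatically continuous.\<close>
  have "(\<exists>\<beta>. homeomorphism {0..t} (\<alpha> ` {0..t}) \<alpha> \<beta>) \<longleftrightarrow> inj_on \<alpha> {0..t}"
    if "continuous_on {0..t} \<alpha>"
  proof
    show "inj_on \<alpha> {0..t}" if "\<exists>\<beta>. homeomorphism {0..t} (\<alpha> ` {0..t}) \<alpha> \<beta>"
      using that by (auto intro: inj_on_inverseI homeomorphism_apply1)
    show "\<exists>\<beta>. homeomorphism {0..t} (\<alpha> ` {0..t}) \<alpha> \<beta>" if "inj_on \<alpha> {0..t}"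
      using homeomorphism_compact[OF compact_Icc \<open>continuous_on {0..t} \<alpha>\<close> refl that] .
  qed
  then show ?thesis
    by (auto simp: Rep_def)
qed

lemma Rep_mono:
  assumes "\<alpha> \<in> Rep {0..t'}" "t \<le> t'"
  shows "\<alpha> \<in> Rep {0..t}"
proof -
  have "{0..t} \<subseteq> {0..t'}"
    using assms(2) by auto
  then show ?thesis
    using assms(1) continuous_on_subset inj_on_subset unfolding Rep_atLeastAtMost by blast
qed

lemma id_in_Rep: "(\<lambda>s. s) \<in> Rep {0..t}"
  by (simp add: Rep_atLeastAtMost)

lemma rball_antimono_time:
  assumes "t \<le> t'"
  shows "rball \<phi> x t' \<epsilon> \<subseteq> rball \<phi> x t \<epsilon>"
proof
  fix y assume "y \<in> rball \<phi> x t' \<epsilon>"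
  then obtain \<alpha> where "\<alpha> \<in> Rep {0..t'}" "\<forall>s\<in>{0..t'}. dist (\<phi> (\<alpha> s) x) (\<phi> s y) < \<epsilon>"
    unfolding rball_def by blast
  then have "\<alpha> \<in> Rep {0..t}" "\<forall>s\<in>{0..t}. dist (\<phi> (\<alpha> s) x) (\<phi> s y) < \<epsilon>"
    using assms by (auto intro: Rep_mono)
  then show "y \<in> rball \<phi> x t \<epsilon>"
    unfolding rball_def by blast
qed

lemma rball_mono: "\<epsilon> \<le> \<epsilon>' \<Longrightarrow> rball \<phi> x t \<epsilon> \<subseteq> rball \<phi> x t \<epsilon>'"
  unfolding rball_def by (intro Collect_mono impI, elim bexE, rule bexI) (auto intro: less_le_trans)

lemma rcball_mono: "\<epsilon> \<le> \<epsilon>' \<Longrightarrow> rcball \<phi> x t \<epsilon> \<subseteq> rcball \<phi> x t \<epsilon>'"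
  unfolding rcball_def by (intro Collect_mono impI, elim bexE, rule bexI) (auto intro: order_trans)

locale compact_flow =
  fixes \<phi> :: "real \<Rightarrow> 'a::metric_space \<Rightarrow> 'a"
  assumes compact_UNIV: "compact (UNIV :: 'a set)"
    and flow: "flow \<phi>"
begin

lemma flow_add: "\<phi> (s + t) x = \<phi> t (\<phi> s x)"
  using flow unfolding flow_def by (metis comp_apply)

text \<open>The group law only makes \<open>\<phi> 0\<close> idempotent; its injectivity as a
  homeomorphism turns it into the identity.\<close>

lemma flow_zero [simp]: "\<phi> 0 x = x"
proof -
  obtain \<psi> where "homeomorphism UNIV UNIV (\<phi> 0) \<psi>"
    using flow unfolding flow_def by blast
  then have "\<psi> (\<phi> 0 y) = y" for y
    by (simp add: homeomorphism_def)
  then show ?thesis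
    by (metis add.right_neutral flow_add)
qed

lemma continuous_on_flow: "continuous_on UNIV (\<lambda>p. \<phi> (snd p) (fst p))"
  using flow unfolding flow_def by (simp add: case_prod_beta)

lemma continuous_on_flow_comp [continuous_intros]:
  assumes "continuous_on S f" "continuous_on S g"
  shows "continuous_on S (\<lambda>z. \<phi> (f z) (g z))"
  using continuous_on_compose2[OF continuous_on_flow continuous_on_Pair[OF assms(2,1)]] by simp

lemma uniformly_continuous_flow:
  assumes "e > 0"
  obtains d where "d > 0"
    "\<And>x y u. dist x y < d \<Longrightarrow> \<bar>u\<bar> \<le> R \<Longrightarrow> dist (\<phi> u x) (\<phi> u y) < e"
proof -
  let ?S = "UNIV \<times> {-R..R}"
  have "uniformly_continuous_on ?S (\<lambda>p. \<phi> (snd p) (fst p))"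
    by (intro compact_uniformly_continuous continuous_on_subset[OF continuous_on_flow]
        compact_Times compact_UNIV compact_Icc subset_UNIV)
  then obtain d where d: "d > 0" "\<forall>p\<in>?S. \<forall>p'\<in>?S. dist p' p < d \<longrightarrow>
      dist (\<phi> (snd p') (fst p')) (\<phi> (snd p) (fst p)) < e"
    unfolding uniformly_continuous_on_def using assms by meson
  show thesis
  proof
    show "dist (\<phi> u x) (\<phi> u y) < e" if "dist x y < d" "\<bar>u\<bar> \<le> R" for x y u
      using d(2)[rule_format, of "(y, u)" "(x, u)"] that by (auto simp: dist_Pair_Pair abs_le_iff)
  qed fact
qed

text \<open>The tracking error attains a maximum \<open>M\<close> over the compact time interval,
  and \<open>\<epsilon> - M\<close> is the room for moving \<open>y\<close> while
  \<open>\<alpha>\<close> is kept. Openness makes these balls Borel.\<close>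

lemma open_rball: "open (rball \<phi> x t \<epsilon>)"
  unfolding open_dist
proof
  fix y assume "y \<in> rball \<phi> x t \<epsilon>"
  then obtain \<alpha> where \<alpha>: "\<alpha> \<in> Rep {0..t}"
    and near: "\<And>s. s \<in> {0..t} \<Longrightarrow> dist (\<phi> (\<alpha> s) x) (\<phi> s y) < \<epsilon>"
    unfolding rball_def by blast
  obtain M where M: "M < \<epsilon>" "\<And>s. s \<in> {0..t} \<Longrightarrow> dist (\<phi> (\<alpha> s) x) (\<phi> s y) \<le> M"
  proof (cases "0 \<le> t")
    case True
    have "continuous_on {0..t} (\<lambda>s. dist (\<phi> (\<alpha> s) x) (\<phi> s y))"
      using \<alpha> unfolding Rep_atLeastAtMost by (intro continuous_intros) auto
    then obtain s0 where "s0 \<in> {0..t}"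
      "\<forall>s\<in>{0..t}. dist (\<phi> (\<alpha> s) x) (\<phi> s y) \<le> dist (\<phi> (\<alpha> s0) x) (\<phi> s0 y)"
      using continuous_attains_sup[of "{0..t}" "\<lambda>s. dist (\<phi> (\<alpha> s) x) (\<phi> s y)"] True by auto
    then show thesis
      using near that by blast
  next
    case False
    then show thesis
      using that[of "\<epsilon> - 1"] by auto
  qed
  have "\<epsilon> - M > 0"
    using M(1) by simp
  then obtain d where d: "d > 0"
    "\<And>y y' u. dist y y' < d \<Longrightarrow> \<bar>u\<bar> \<le> t \<Longrightarrow> dist (\<phi> u y) (\<phi> u y') < \<epsilon> - M"
    by (rule uniformly_continuous_flow) (rule that, assumption, blast)
  have "y' \<in> rball \<phi> x t \<epsilon>" if "dist y' y < d" for y'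
  proof -
    have "dist (\<phi> (\<alpha> s) x) (\<phi> s y') < \<epsilon>" if "s \<in> {0..t}" for s
      using M(2)[OF that] d(2)[of y y' s] \<open>dist y' y < d\<close> that
        dist_triangle[of "\<phi> (\<alpha> s) x" "\<phi> s y'" "\<phi> s y"]
      by (auto simp: dist_commute)
    then show ?thesis
      unfolding rball_def using \<alpha> by blast
  qed
  then show "\<exists>e>0. \<forall>y'. dist y' y < e \<longrightarrow> y' \<in> rball \<phi> x t \<epsilon>"
    using d(1) by blast
qed

text \<open>The identity serves as time change. As \<open>d\<close> is independent of the points,
  the centers of disjoint balls of equal time are uniformly separated.\<close>

lemma dist_less_in_rcball:
  assumes "\<epsilon> > 0"
  obtains d where "d > 0" "\<And>x y. dist x y < d \<Longrightarrow> y \<in> rcball \<phi> x t \<epsilon>"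
proof -
  obtain d where d: "d > 0"
    "\<And>x y u. dist x y < d \<Longrightarrow> \<bar>u\<bar> \<le> t \<Longrightarrow> dist (\<phi> u x) (\<phi> u y) < \<epsilon>"
    using uniformly_continuous_flow[OF assms] by blast
  show thesis
  proof
    show "y \<in> rcball \<phi> x t \<epsilon>" if "dist x y < d" for x y
      unfolding rcball_def using d(2)[OF that] by (auto intro!: bexI[OF _ id_in_Rep] less_imp_le)
  qed fact
qed

end

section \<open>Speed of time changes without fixed points\<close>

locale fixed_point_free_flow = compact_flow +
  assumes no_fixed_points: "no_fixed_points \<phi>"
begin

text \<open>Arbitrarily small periods accumulate at a fixed point.\<close>

lemma no_small_periods:
  obtains \<tau>0 where "\<tau>0 > 0" "\<And>\<tau> x. 0 < \<tau> \<Longrightarrow> \<tau> < \<tau>0 \<Longrightarrow> \<phi> \<tau> x \<noteq> x"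
proof (rule ccontr)
  assume neg: "\<not> thesis"
  have "\<exists>\<tau> x. 0 < \<tau> \<and> \<tau> < 1 / real (Suc n) \<and> \<phi> \<tau> x = x" for n
    using neg that[of "1 / real (Suc n)"] by (metis of_nat_0_less_iff zero_less_Suc zero_less_divide_1_iff)
  then obtain \<tau> x where \<tau>: "\<And>n. 0 < \<tau> n" "\<And>n. \<tau> n < 1 / real (Suc n)"
    and per: "\<And>n. \<phi> (\<tau> n) (x n) = x n"
    by metis
  obtain l r where r: "strict_mono r" and l: "(x \<circ> r) \<longlonglongrightarrow> l"
    using compact_UNIV unfolding compact_def by (metis UNIV_I)
  have mult: "\<phi> (real k * \<tau> n) (x n) = x n" for k n
    by (induction k) (simp_all add: algebra_simps flow_add per)
  have mult_int: "\<phi> (real_of_int k * \<tau> n) (x n) = x n" for k n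
  proof (cases "k \<ge> 0")
    case True
    then show ?thesis
      using mult[of "nat k" n] by simp
  next
    case False
    have "\<phi> (real_of_int k * \<tau> n) (x n)
        = \<phi> (real_of_int k * \<tau> n) (\<phi> (real (nat (- k)) * \<tau> n) (x n))"
      using mult by simp
    also have "\<dots> = x n"
      using False by (simp flip: flow_add)
    finally show ?thesis .
  qed
  have \<tau>_lim: "\<tau> \<longlonglongrightarrow> 0"
    using LIMSEQ_inverse_real_of_nat
    by (rule tendsto_sandwich[OF _ _ tendsto_const, rotated 2])
      (use \<tau> in \<open>auto simp: inverse_eq_divide intro!: always_eventually less_imp_le\<close>)
  have "\<phi> t l = l" for t
  proof -
    \<comment> \<open>The remainder of \<open>t\<close> modulo the period \<open>\<tau> n\<close>:
      flowing \<open>x n\<close> for time \<open>t\<close> or \<open>\<rho> n\<close> gives the same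
      point, and \<open>\<rho>\<close> tends to 0 with \<open>\<tau>\<close>.\<close>
    define \<rho> where "\<rho> n = t - of_int \<lfloor>t / \<tau> n\<rfloor> * \<tau> n" for n
    have \<rho>: "0 \<le> \<rho> n" "\<rho> n \<le> \<tau> n" for n
    proof -
      have "of_int \<lfloor>t / \<tau> n\<rfloor> * \<tau> n \<le> t"
        using \<tau>(1)[of n] pos_le_divide_eq of_int_floor_le by blast
      moreover have "t \<le> (of_int \<lfloor>t / \<tau> n\<rfloor> + 1) * \<tau> n"
        using \<tau>(1)[of n] by (simp flip: pos_divide_le_eq) 
      ultimately show "0 \<le> \<rho> n" "\<rho> n \<le> \<tau> n"
        using \<tau>(1)[of n] unfolding \<rho>_def by (simp_all add: field_simps)
    qed
    have "\<rho> \<longlonglongrightarrow> 0"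
      by (rule tendsto_sandwich[OF _ _ tendsto_const \<tau>_lim]) (use \<rho> in auto)
    then have \<rho>r: "(\<rho> \<circ> r) \<longlonglongrightarrow> 0"
      using r LIMSEQ_subseq_LIMSEQ by blast
    have eq: "\<phi> t (x n) = \<phi> (\<rho> n) (x n)" for n
      using flow_add[of "of_int \<lfloor>t / \<tau> n\<rfloor> * \<tau> n" "\<rho> n" "x n"] mult_int[of "\<lfloor>t / \<tau> n\<rfloor>" n]
      by (simp add: \<rho>_def)
    have cont: "isCont (\<lambda>p. \<phi> (snd p) (fst p)) p" for p
      using continuous_on_flow continuous_on_eq_continuous_at open_UNIV by blast
    have "(\<lambda>n. \<phi> t (x (r n))) \<longlonglongrightarrow> \<phi> t l"
      using isCont_tendsto_compose[OF cont tendsto_Pair[OF l tendsto_const[of t]]] by (simp add: o_def)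
    moreover have "(\<lambda>n. \<phi> t (x (r n))) \<longlonglongrightarrow> l"
      using isCont_tendsto_compose[OF cont tendsto_Pair[OF l \<rho>r]] by (simp add: o_def eq)
    ultimately show ?thesis
      using LIMSEQ_unique by blast
  qed
  then show False
    using no_fixed_points unfolding no_fixed_points_def by blast
qed

text \<open>The displacement has a positive minimum on the compact space. The backward displacement
  of \<open>x\<close> is the forward one of \<open>\<phi> (- \<tau>) x\<close>, so one
  \<open>\<gamma>\<close> serves both directions.\<close>

lemma displacement_bound:
  assumes "0 < \<tau>" "\<And>x. \<phi> \<tau> x \<noteq> x"
  obtains \<gamma> where "\<gamma> > 0" "\<And>x. \<gamma> \<le> dist (\<phi> \<tau> x) x" "\<And>x. \<gamma> \<le> dist (\<phi> (- \<tau>) x) x"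
proof -
  have "continuous_on UNIV (\<lambda>x. dist (\<phi> \<tau> x) x)"
    by (intro continuous_intros)
  then obtain x0 where x0: "\<And>x. dist (\<phi> \<tau> x0) x0 \<le> dist (\<phi> \<tau> x) x"
    using continuous_attains_inf[OF compact_UNIV] by blast
  show thesis
  proof (rule that)
    show "0 < dist (\<phi> \<tau> x0) x0" using assms by simp
    show "dist (\<phi> \<tau> x0) x0 \<le> dist (\<phi> \<tau> x) x" for x by (rule x0)
    show "dist (\<phi> \<tau> x0) x0 \<le> dist (\<phi> (- \<tau>) x) x" for x
      using x0[of "\<phi> (- \<tau>) x"] flow_add[of "- \<tau>" \<tau> x] by (simp add: dist_commute)
  qed
qed

text \<open>Were the clock error to reach \<open>\<delta>'\<close> within one unit of time, some point would be moved by
  \<open>\<phi>\<^bsub>\<plusminus>\<delta>'\<^esub>\<close> by less than the minimal displacement.\<close>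

lemma tracking_time_change:
  assumes "\<delta> > 0"
  obtains \<epsilon> where "\<epsilon> > 0"
    "\<And>\<alpha> t x y s. continuous_on {0..t} \<alpha> \<Longrightarrow> \<alpha> 0 = 0 \<Longrightarrow>
       \<forall>s\<in>{0..t}. dist (\<phi> (\<alpha> s) x) (\<phi> s y) \<le> \<epsilon> \<Longrightarrow>
       s \<in> {0..t} \<Longrightarrow> \<bar>\<alpha> s - s\<bar> \<le> \<delta> * (s + 1)"
proof -
  obtain \<tau>0 where \<tau>0: "\<tau>0 > 0" "\<And>\<tau> x. 0 < \<tau> \<Longrightarrow> \<tau> < \<tau>0 \<Longrightarrow> \<phi> \<tau> x \<noteq> x"
    using no_small_periods by blast
  \<comment> \<open>Below \<open>\<tau>0\<close>, so that no point is fixed by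
    \<open>\<phi> \<delta>'\<close> and the displacement bound applies.\<close>
  define \<delta>' where "\<delta>' = min \<delta> (\<tau>0 / 2)"
  have \<delta>': "0 < \<delta>'" "\<delta>' \<le> \<delta>" "\<delta>' < \<tau>0"
    using assms \<tau>0(1) unfolding \<delta>'_def by auto
  obtain \<gamma> where \<gamma>: "\<gamma> > 0" "\<And>x. \<gamma> \<le> dist (\<phi> \<delta>' x) x" "\<And>x. \<gamma> \<le> dist (\<phi> (- \<delta>') x) x"
    using displacement_bound[OF \<delta>'(1) \<tau>0(2)[OF \<delta>'(1,3)]] by blast
  obtain \<eta> where \<eta>: "\<eta> > 0"
    "\<And>x y u. dist x y < \<eta> \<Longrightarrow> \<bar>u\<bar> \<le> 1 \<Longrightarrow> dist (\<phi> u x) (\<phi> u y) < \<gamma> / 2"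
    using uniformly_continuous_flow[OF half_gt_zero[OF \<gamma>(1)]] by blast
  define \<epsilon> where "\<epsilon> = min (\<eta> / 2) (\<gamma> / 2)"
  have \<epsilon>: "0 < \<epsilon>" "\<epsilon> < \<eta>" "\<epsilon> \<le> \<gamma> / 2"
    using \<eta>(1) \<gamma>(1) unfolding \<epsilon>_def by auto
  show thesis
  proof (rule that[OF \<epsilon>(1)])
    fix \<alpha> t x y s
    assume cont: "continuous_on {0..t} \<alpha>" and "\<alpha> 0 = 0"
      and near: "\<forall>s\<in>{0..t}. dist (\<phi> (\<alpha> s) x) (\<phi> s y) \<le> \<epsilon>"
      and s: "s \<in> {0..t}"
    have step: "\<bar>\<alpha> (a + u) - \<alpha> a - u\<bar> < \<delta>'" if "0 \<le> a" "0 \<le> u" "u \<le> 1" "a + u \<le> t" for a u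
    proof (rule ccontr)
      assume "\<not> ?thesis"
      moreover have "continuous_on {0..u} (\<lambda>v. \<bar>\<alpha> (a + v) - \<alpha> a - v\<bar>)"
        using that by (intro continuous_intros continuous_on_compose2[OF cont]) auto
      \<comment> \<open>The error vanishes at 0, so by continuity it equals \<open>\<delta>'\<close>
        exactly at some \<open>v\<close>.\<close>
      ultimately obtain v where v: "0 \<le> v" "v \<le> u" "\<bar>\<alpha> (a + v) - \<alpha> a - v\<bar> = \<delta>'"
        using IVT'[of "\<lambda>v. \<bar>\<alpha> (a + v) - \<alpha> a - v\<bar>" 0 \<delta>' u] \<delta>'(1) \<open>0 \<le> u\<close>
        by (auto simp del: One_nat_def)
      \<comment> \<open>\<open>q\<close> starts next to \<open>\<phi> a y\<close> and flows for the
        same time \<open>v \<le> 1\<close>, hence stays near \<open>\<phi> (a + v) y\<close>. Its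
        translate by time \<open>\<delta>'\<close> or \<open>- \<delta>'\<close> is near that point
        too.\<close>
      define q where "q = \<phi> v (\<phi> (\<alpha> a) x)"
      have "dist q (\<phi> (a + v) y) < \<gamma> / 2"
        unfolding q_def flow_add using v that near[rule_format, of a] \<epsilon>(2) by (intro \<eta>(2)) auto
      moreover have "dist (\<phi> (\<alpha> (a + v)) x) (\<phi> (a + v) y) \<le> \<gamma> / 2"
        using near[rule_format, of "a + v"] v that \<epsilon>(3) by auto
      moreover have "\<phi> (\<alpha> (a + v)) x = \<phi> (\<alpha> (a + v) - \<alpha> a - v) q"
        unfolding q_def by (simp flip: flow_add)
      ultimately have "dist (\<phi> (\<alpha> (a + v) - \<alpha> a - v) q) q < \<gamma>"
        by (smt (verit, best) dist_triangle2 field_sum_of_halves)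
      moreover have "\<alpha> (a + v) - \<alpha> a - v = \<delta>' \<or> \<alpha> (a + v) - \<alpha> a - v = - \<delta>'"
        using v(3) by linarith
      ultimately show False
        using \<gamma>(2,3)[of q] by auto
    qed
    \<comment> \<open>Each window of length at most 1 adds at most \<open>\<delta>'\<close>;
      rounding \<open>s\<close> up to an integer later produces the \<open>s + 1\<close>.\<close>
    have "\<bar>\<alpha> s - s\<bar> \<le> \<delta>' * real n" if "s \<in> {0..t}" "s \<le> real n" for n s
      using that
    proof (induction n arbitrary: s)
      case 0
      then show ?case using \<open>\<alpha> 0 = 0\<close> by simp
    next
      case (Suc n)
      define a where "a = max 0 (s - 1)"
      have a: "a \<in> {0..t}" "a \<le> real n" "0 \<le> s - a" "s - a \<le> 1"
        using Suc.prems unfolding a_def by auto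
      show ?case
        using Suc.IH[OF a(1,2)] step[of a "s - a"] a Suc.prems
        by (auto simp: algebra_simps)
    qed
    from this[of s "nat \<lceil>s\<rceil>"] have "\<bar>\<alpha> s - s\<bar> \<le> \<delta>' * real (nat \<lceil>s\<rceil>)"
      using s by (simp add: of_nat_ceiling)
    also have "\<dots> \<le> \<delta> * (s + 1)"
      using s \<delta>' by (intro mult_mono) (simp_all add: le_of_int_ceiling of_nat_nat, linarith?)
    finally show "\<bar>\<alpha> s - s\<bar> \<le> \<delta> * (s + 1)" .
  qed
qed

text \<open>Ensures that the image of a time change is long enough to be inverted on
  \<open>{0..r}\<close>. The hypothesis \<open>r \<ge> 1\<close> absorbs the additive 1 in the clock
  error.\<close>

lemma tracking_time_bound:
  assumes "\<kappa> > 1"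
  obtains \<epsilon> where "\<epsilon> > 0"
    "\<And>\<alpha> r x y. \<alpha> \<in> Rep {0..\<kappa> * r} \<Longrightarrow> r \<ge> 1 \<Longrightarrow>
       \<forall>s\<in>{0..\<kappa> * r}. dist (\<phi> (\<alpha> s) x) (\<phi> s y) \<le> \<epsilon> \<Longrightarrow> r \<le> \<alpha> (\<kappa> * r)"
proof -
  \<comment> \<open>Solves \<open>\<kappa> * r - \<delta> * (\<kappa> * r + r) = r\<close>.\<close>
  define \<delta> where "\<delta> = (\<kappa> - 1) / (\<kappa> + 1)"
  have "\<delta> > 0" and \<delta>: "\<delta> * (\<kappa> + 1) = \<kappa> - 1"
    using assms unfolding \<delta>_def by auto
  obtain \<epsilon> where \<epsilon>: "\<epsilon> > 0"
    "\<And>\<alpha> t x y s. continuous_on {0..t} \<alpha> \<Longrightarrow> \<alpha> 0 = 0 \<Longrightarrow>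
       \<forall>s\<in>{0..t}. dist (\<phi> (\<alpha> s) x) (\<phi> s y) \<le> \<epsilon> \<Longrightarrow>
       s \<in> {0..t} \<Longrightarrow> \<bar>\<alpha> s - s\<bar> \<le> \<delta> * (s + 1)"
    by (rule tracking_time_change[OF \<open>\<delta> > 0\<close>]) (rule that, assumption, blast)
  show thesis
  proof (rule that[OF \<epsilon>(1)])
    fix \<alpha> r x y
    assume \<alpha>: "\<alpha> \<in> Rep {0..\<kappa> * r}" and r: "r \<ge> 1"
      and near: "\<forall>s\<in>{0..\<kappa> * r}. dist (\<phi> (\<alpha> s) x) (\<phi> s y) \<le> \<epsilon>"
    have "\<bar>\<alpha> (\<kappa> * r) - \<kappa> * r\<bar> \<le> \<delta> * (\<kappa> * r + 1)"
      by (rule \<epsilon>(2)[OF _ _ near]) (use \<alpha> r assms in \<open>auto simp: Rep_atLeastAtMost\<close>)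
    also have "\<dots> \<le> \<delta> * (\<kappa> * r + r)"
      using r \<open>\<delta> > 0\<close> by simp
    also have "\<dots> = (\<delta> * (\<kappa> + 1)) * r"
      by (simp add: algebra_simps)
    also have "\<dots> = (\<kappa> - 1) * r"
      unfolding \<delta> ..
    finally show "r \<le> \<alpha> (\<kappa> * r)"
      by (simp add: algebra_simps abs_le_iff)
  qed
qed

text \<open>If two closed balls meet, composing one time change with the inverse of the other shows that
  each center tracks the other; the time lost is controlled by \<open>\<kappa>\<close>.\<close>

lemma meeting_rcballs:
  assumes "\<kappa> > 1"
  obtains \<epsilon>0 where "\<epsilon>0 > 0"
    "\<And>\<epsilon> \<epsilon>' x y r. 2 * \<epsilon>' < \<epsilon> \<Longrightarrow> \<epsilon>' \<le> \<epsilon>0 \<Longrightarrow> r \<ge> 1 \<Longrightarrow>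
      rcball \<phi> x (\<kappa> * r) \<epsilon>' \<inter> rcball \<phi> y (\<kappa> * r) \<epsilon>' \<noteq> {} \<Longrightarrow> y \<in> rball \<phi> x r \<epsilon>"
proof -
  obtain \<epsilon>0 where \<epsilon>0: "\<epsilon>0 > 0"
    "\<And>\<alpha> r x y. \<alpha> \<in> Rep {0..\<kappa> * r} \<Longrightarrow> r \<ge> 1 \<Longrightarrow>
       \<forall>s\<in>{0..\<kappa> * r}. dist (\<phi> (\<alpha> s) x) (\<phi> s y) \<le> \<epsilon>0 \<Longrightarrow> r \<le> \<alpha> (\<kappa> * r)"
    by (rule tracking_time_bound[OF assms]) (rule that, assumption, blast)
  show thesis
  proof (rule that[OF \<epsilon>0(1)])
    fix \<epsilon> \<epsilon>' x y r
    assume \<epsilon>: "2 * \<epsilon>' < \<epsilon>" "\<epsilon>' \<le> \<epsilon>0" and r: "r \<ge> 1"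
      and meet: "rcball \<phi> x (\<kappa> * r) \<epsilon>' \<inter> rcball \<phi> y (\<kappa> * r) \<epsilon>' \<noteq> {}"
    define T where "T = \<kappa> * r"
    have "T > 0"
      using r assms unfolding T_def by simp
    from meet obtain z where z: "z \<in> rcball \<phi> x T \<epsilon>'" "z \<in> rcball \<phi> y T \<epsilon>'"
      unfolding T_def by blast
    from z(1) obtain \<alpha> where \<alpha>: "\<alpha> \<in> Rep {0..T}"
      and near_x: "\<And>s. s \<in> {0..T} \<Longrightarrow> dist (\<phi> (\<alpha> s) x) (\<phi> s z) \<le> \<epsilon>'"
      unfolding rcball_def by blast
    from z(2) obtain \<beta> where \<beta>: "\<beta> \<in> Rep {0..T}"
      and near_y: "\<And>s. s \<in> {0..T} \<Longrightarrow> dist (\<phi> (\<beta> s) y) (\<phi> s z) \<le> \<epsilon>'"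
      unfolding rcball_def by blast
    have "\<forall>s\<in>{0..\<kappa> * r}. dist (\<phi> (\<beta> s) y) (\<phi> s z) \<le> \<epsilon>0"
      using near_y \<epsilon>(2) unfolding T_def by fastforce
    then have "r \<le> \<beta> T"
      using \<epsilon>0(2) \<beta> r unfolding T_def by blast
    obtain \<theta> where \<theta>: "homeomorphism {0..T} (\<beta> ` {0..T}) \<beta> \<theta>"
      using \<beta> unfolding Rep_def by blast
    \<comment> \<open>The image of \<open>\<beta>\<close> is an interval containing \<open>0\<close>
      and a point at least \<open>r\<close>, so its inverse \<open>\<theta>\<close> is defined on
      \<open>{0..r}\<close>; the time change sought is
      \<open>\<alpha> \<circ> \<theta>\<close>.\<close>
    have "connected (\<beta> ` {0..T})"
      using \<beta> unfolding Rep_atLeastAtMost by (intro connected_continuous_image) auto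
    moreover have "0 \<in> \<beta> ` {0..T}" "\<beta> T \<in> \<beta> ` {0..T}"
      using \<beta> \<open>T > 0\<close> unfolding Rep_atLeastAtMost by force+
    ultimately have sub: "{0..r} \<subseteq> \<beta> ` {0..T}"
      using \<open>r \<le> \<beta> T\<close> connected_contains_Icc[of "\<beta> ` {0..T}" 0 "\<beta> T"] by force
    have \<theta>_in: "\<theta> u \<in> {0..T}" "\<beta> (\<theta> u) = u" if "u \<in> {0..r}" for u
      using that sub \<theta> unfolding homeomorphism_def by auto
    have \<theta>_inj: "inj_on \<theta> {0..r}"
      using \<theta>_in(2) by (metis inj_onI)
    have \<theta>_img: "\<theta> ` {0..r} \<subseteq> {0..T}"
      using \<theta>_in by blast
    have "continuous_on {0..r} \<theta>"
      using homeomorphism_cont2[OF \<theta>] sub by (rule continuous_on_subset)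
    moreover have "continuous_on (\<theta> ` {0..r}) \<alpha>" "inj_on \<alpha> (\<theta> ` {0..r})"
      using \<alpha> continuous_on_subset[OF _ \<theta>_img] inj_on_subset[OF _ \<theta>_img]
      unfolding Rep_atLeastAtMost by auto
    ultimately have "continuous_on {0..r} (\<alpha> \<circ> \<theta>)" "inj_on (\<alpha> \<circ> \<theta>) {0..r}"
      using \<theta>_inj by (simp_all add: continuous_on_compose comp_inj_on del: o_apply)
    moreover have "\<theta> 0 = 0"
    proof -
      have "\<beta> 0 = 0" "0 \<in> {0..T}"
        using \<beta> \<open>T > 0\<close> unfolding Rep_atLeastAtMost by auto
      then show ?thesis
        using homeomorphism_apply1[OF \<theta>, of 0] by simp
    qed
    ultimately have "\<alpha> \<circ> \<theta> \<in> Rep {0..r}"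
      using \<alpha> unfolding Rep_atLeastAtMost by simp
    moreover have "dist (\<phi> ((\<alpha> \<circ> \<theta>) u) x) (\<phi> u y) < \<epsilon>" if "u \<in> {0..r}" for u
    proof -
      have "dist (\<phi> (\<alpha> (\<theta> u)) x) (\<phi> (\<theta> u) z) \<le> \<epsilon>'" "dist (\<phi> u y) (\<phi> (\<theta> u) z) \<le> \<epsilon>'"
        using near_x[OF \<theta>_in(1)[OF that]] near_y[OF \<theta>_in(1)[OF that]] \<theta>_in(2)[OF that] by simp_all
      then show ?thesis
        using \<epsilon>(1) dist_triangle2[of "\<phi> (\<alpha> (\<theta> u)) x" "\<phi> u y" "\<phi> (\<theta> u) z"] by simp
    qed
    ultimately show "y \<in> rball \<phi> x r \<epsilon>"
      unfolding rball_def by (intro CollectI bexI[of _ "\<alpha> \<circ> \<theta>"]) auto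
  qed
qed

text \<open>A time change could run arbitrarily far along the orbit, where nearby centers separate.
  For small radius the clock error bound with \<open>\<delta> = 1\<close> confines it to times of
  modulus at most \<open>2 * t + 1\<close>, where uniform continuity applies; the halved radius pays
  for moving the center.\<close>

lemma rball_subset_rcball:
  obtains \<epsilon>0 where "\<epsilon>0 > 0"
    "\<And>\<epsilon> t. 0 < \<epsilon> \<Longrightarrow> \<epsilon> \<le> \<epsilon>0 \<Longrightarrow>
      \<exists>d>0. \<forall>x z. dist x z < d \<longrightarrow> rball \<phi> z t (\<epsilon> / 2) \<subseteq> rcball \<phi> x t \<epsilon>"
proof -
  obtain \<epsilon>0 where \<epsilon>0: "\<epsilon>0 > 0"
    "\<And>\<alpha> t x y s. continuous_on {0..t} \<alpha> \<Longrightarrow> \<alpha> 0 = 0 \<Longrightarrow>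
       \<forall>s\<in>{0..t}. dist (\<phi> (\<alpha> s) x) (\<phi> s y) \<le> \<epsilon>0 \<Longrightarrow>
       s \<in> {0..t} \<Longrightarrow> \<bar>\<alpha> s - s\<bar> \<le> 1 * (s + 1)"
    using tracking_time_change[OF zero_less_one] by blast
  show thesis
  proof (rule that[OF \<epsilon>0(1)])
    fix \<epsilon> t :: real assume \<epsilon>: "0 < \<epsilon>" "\<epsilon> \<le> \<epsilon>0"
    obtain d where d: "d > 0" "\<And>x y u. dist x y < d \<Longrightarrow> \<bar>u\<bar> \<le> 2 * t + 1 \<Longrightarrow>
        dist (\<phi> u x) (\<phi> u y) < \<epsilon> / 2"
      using uniformly_continuous_flow[OF half_gt_zero[OF \<epsilon>(1)]] by blast
    have "rball \<phi> z t (\<epsilon> / 2) \<subseteq> rcball \<phi> x t \<epsilon>" if xz: "dist x z < d" for x z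
    proof
      fix y assume "y \<in> rball \<phi> z t (\<epsilon> / 2)"
      then obtain \<alpha> where \<alpha>: "\<alpha> \<in> Rep {0..t}"
        and near: "\<And>s. s \<in> {0..t} \<Longrightarrow> dist (\<phi> (\<alpha> s) z) (\<phi> s y) < \<epsilon> / 2"
        unfolding rball_def by blast
      have "dist (\<phi> (\<alpha> s) x) (\<phi> s y) \<le> \<epsilon>" if s: "s \<in> {0..t}" for s
      proof -
        have near': "\<forall>s\<in>{0..t}. dist (\<phi> (\<alpha> s) z) (\<phi> s y) \<le> \<epsilon>0"
          using near \<epsilon> by fastforce
        have "\<bar>\<alpha> s - s\<bar> \<le> 1 * (s + 1)"
          by (rule \<epsilon>0(2)[OF _ _ near' s]) (use \<alpha> in \<open>auto simp: Rep_atLeastAtMost\<close>)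
        then have "\<bar>\<alpha> s\<bar> \<le> 2 * t + 1"
          using s by auto
        then have "dist (\<phi> (\<alpha> s) x) (\<phi> (\<alpha> s) z) < \<epsilon> / 2"
          using d(2) xz by blast
        then show ?thesis
          using near[OF s] dist_triangle[of "\<phi> (\<alpha> s) x" "\<phi> s y" "\<phi> (\<alpha> s) z"] by linarith
      qed
      then show "y \<in> rcball \<phi> x t \<epsilon>"
        unfolding rcball_def using \<alpha> by blast
    qed
    then show "\<exists>d>0. \<forall>x z. dist x z < d \<longrightarrow> rball \<phi> z t (\<epsilon> / 2) \<subseteq> rcball \<phi> x t \<epsilon>"
      using d(1) by blast
  qed
qed

end

section \<open>Packing measures\<close>

lemma center_in_rcball: "0 \<le> \<epsilon> \<Longrightarrow> x \<in> rcball \<phi> x t \<epsilon>"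
  unfolding rcball_def by (intro CollectI bexI[OF _ id_in_Rep]) simp

lemma center_in_rball: "0 < \<epsilon> \<Longrightarrow> x \<in> rball \<phi> x t \<epsilon>"
  unfolding rball_def by (intro CollectI bexI[OF _ id_in_Rep]) simp

lemma packing_pre_mono:
  assumes "N' \<le> N" "s' \<le> s" "\<epsilon>' \<le> \<epsilon>" "Z \<subseteq> Z'"
  shows "packing_pre \<phi> s \<epsilon> N Z \<le> packing_pre \<phi> s' \<epsilon>' N' Z'"
  unfolding packing_pre_def[of \<phi> s]
proof (rule Sup_least, elim CollectE exE conjE)
  fix a and I :: "nat set" and x t
  assume a: "a = (\<Sum>\<^sub>\<infinity>i\<in>I. ennreal (exp (- s * t i)))"
    and adm: "\<forall>i\<in>I. x i \<in> Z \<and> 0 < t i \<and> real N \<le> t i"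
    and disj: "disjoint_family_on (\<lambda>i. rcball \<phi> (x i) (t i) \<epsilon>) I"
  have "a \<le> (\<Sum>\<^sub>\<infinity>i\<in>I. ennreal (exp (- s' * t i)))"
    unfolding a using adm assms(2)
    by (intro infsum_mono nonneg_summable_on_complete ennreal_leI) auto
  also have "\<dots> \<le> packing_pre \<phi> s' \<epsilon>' N' Z'"
    unfolding packing_pre_def
  proof (intro Sup_upper CollectI exI conjI)
    show "\<forall>i\<in>I. x i \<in> Z' \<and> 0 < t i \<and> real N' \<le> t i"
      using adm assms(1,4) by force
    show "disjoint_family_on (\<lambda>i. rcball \<phi> (x i) (t i) \<epsilon>') I"
      unfolding disjoint_family_on_def
    proof (intro ballI impI)
      fix i j assume "i \<in> I" "j \<in> I" "i \<noteq> j"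
      from disjoint_family_onD[OF disj this]
      show "rcball \<phi> (x i) (t i) \<epsilon>' \<inter> rcball \<phi> (x j) (t j) \<epsilon>' = {}"
        using rcball_mono[OF assms(3), of \<phi> "x i" "t i"] rcball_mono[OF assms(3), of \<phi> "x j" "t j"]
        by blast
    qed
  qed (rule refl)
  finally show "a \<le> packing_pre \<phi> s' \<epsilon>' N' Z'" .
qed

lemma packing_lim_eq_INF: "packing_lim \<phi> s \<epsilon> Z = (INF N. packing_pre \<phi> s \<epsilon> N Z)"
  unfolding packing_lim_def
  by (intro limI LIMSEQ_INF) (simp add: decseq_def packing_pre_mono)

lemma packing_lim_mono:
  assumes "s' \<le> s" "\<epsilon>' \<le> \<epsilon>" "Z \<subseteq> Z'"
  shows "packing_lim \<phi> s \<epsilon> Z \<le> packing_lim \<phi> s' \<epsilon>' Z'"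
  unfolding packing_lim_eq_INF using assms by (intro INF_mono') (simp add: packing_pre_mono)

lemma packing_lim_empty [simp]: "packing_lim \<phi> s \<epsilon> {} = 0"
proof -
  have "packing_pre \<phi> s \<epsilon> N {} = 0" for N
    unfolding packing_pre_def bot_ennreal[symmetric] Sup_bot_conv
    by (auto simp: bot_ennreal dest!: bspec)
  then show ?thesis
    by (simp add: packing_lim_eq_INF)
qed

lemma packing_measure_mono:
  fixes Z :: "'a::metric_space set"
  assumes "s' \<le> s" "\<epsilon>' \<le> \<epsilon>" "Z \<subseteq> Z'"
  shows "packing_measure \<phi> s \<epsilon> Z \<le> packing_measure \<phi> s' \<epsilon>' Z'"
  unfolding packing_measure_def
proof (rule Inf_mono, elim CollectE exE conjE, intro bexI CollectI exI conjI)
  fix Zs :: "nat \<Rightarrow> 'a set"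
  assume "Z' \<subseteq> (\<Union>i. Zs i)"
  then show "Z \<subseteq> (\<Union>i. Zs i)"
    using assms(3) by blast
  show "(\<Sum>i. packing_lim \<phi> s \<epsilon> (Zs i)) \<le> b" if "b = (\<Sum>i. packing_lim \<phi> s' \<epsilon>' (Zs i))" for b
    unfolding that using assms(1,2) by (intro suminf_le packing_lim_mono) auto
qed (rule refl)

lemma packing_measure_le_suminf:
  "Z \<subseteq> (\<Union>i. Zs i) \<Longrightarrow> packing_measure \<phi> s \<epsilon> Z \<le> (\<Sum>i. packing_lim \<phi> s \<epsilon> (Zs i))"
  unfolding packing_measure_def by (intro Inf_lower) blast

lemma packing_measure_le_packing_lim: "packing_measure \<phi> s \<epsilon> Z \<le> packing_lim \<phi> s \<epsilon> Z"
proof -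
  let ?Zs = "\<lambda>i::nat. if i = 0 then Z else {}"
  have "packing_measure \<phi> s \<epsilon> Z \<le> (\<Sum>i. packing_lim \<phi> s \<epsilon> (?Zs i))"
    by (rule packing_measure_le_suminf) auto
  also have "\<dots> = packing_lim \<phi> s \<epsilon> Z"
    by (subst suminf_finite[of "{0}"]) auto
  finally show ?thesis .
qed

lemma packing_measure_lessE:
  fixes Z :: "'a::metric_space set"
  assumes "packing_measure \<phi> s \<epsilon> Z < c"
  obtains Zs :: "nat \<Rightarrow> 'a set" where "Z \<subseteq> (\<Union>i. Zs i)" "(\<Sum>i. packing_lim \<phi> s \<epsilon> (Zs i)) < c"
  using assms unfolding packing_measure_def Inf_less_iff by auto

lemma suminf_half_powers: "0 \<le> e \<Longrightarrow> (\<Sum>i. ennreal (e * (1 / 2) ^ Suc i)) = ennreal e"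
  using sums_mult[OF power_half_series, of e] by (intro suminf_ennreal_eq) auto

text \<open>The \<open>i\<close>-th set receives the budget \<open>e * (1 / 2) ^ Suc i\<close>, and
  the resulting double sequence of pieces is listed as one cover by
  \<open>prod_decode\<close>.\<close>

lemma packing_measure_null_UN:
  fixes A :: "nat \<Rightarrow> 'a::metric_space set"
  assumes null: "\<And>i. packing_measure \<phi> s \<epsilon> (A i) = 0" and cover: "Z \<subseteq> (\<Union>i. A i)"
  shows "packing_measure \<phi> s \<epsilon> Z = 0"
proof -
  have "packing_measure \<phi> s \<epsilon> Z \<le> 0 + ennreal e" if "e > 0" for e
  proof -
    have "\<exists>Zs. A i \<subseteq> (\<Union>j. Zs j) \<and> (\<Sum>j. packing_lim \<phi> s \<epsilon> (Zs j)) < ennreal (e * (1 / 2) ^ Suc i)"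
      for i :: nat
      using packing_measure_lessE[of \<phi> s \<epsilon> "A i" "ennreal (e * (1 / 2) ^ Suc i)"] null[of i] that
      by (metis ennreal_less_zero_iff half_gt_zero_iff mult_pos_pos zero_less_one zero_less_power)
    then obtain W where W: "\<And>i. A i \<subseteq> (\<Union>j. W i j)"
      "\<And>i. (\<Sum>j. packing_lim \<phi> s \<epsilon> (W i j)) < ennreal (e * (1 / 2) ^ Suc i)"
      by metis
    let ?V = "\<lambda>k. case prod_decode k of (i, j) \<Rightarrow> W i j"
    have "Z \<subseteq> (\<Union>k. ?V k)"
    proof
      fix x assume "x \<in> Z"
      then obtain i j where "x \<in> W i j"
        using cover W(1) by blast
      then have "x \<in> ?V (prod_encode (i, j))"
        by simp
      then show "x \<in> (\<Union>k. ?V k)"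
        by (rule UN_I[OF UNIV_I])
    qed
    then have "packing_measure \<phi> s \<epsilon> Z \<le> (\<Sum>k. packing_lim \<phi> s \<epsilon> (?V k))"
      by (rule packing_measure_le_suminf)
    also have "\<dots> = (\<Sum>k. (\<lambda>(i, j). packing_lim \<phi> s \<epsilon> (W i j)) (prod_decode k))"
      by (simp add: case_prod_beta)
    also have "\<dots> = (\<Sum>i. \<Sum>j. packing_lim \<phi> s \<epsilon> (W i j))"
      by (rule suminf_ennreal_2dimen) simp
    also have "\<dots> \<le> (\<Sum>i. ennreal (e * (1 / 2) ^ Suc i))"
      by (intro suminf_le less_imp_le[OF W(2)]) auto
    also have "\<dots> = ennreal e"
      using that by (simp only: suminf_half_powers)
    finally show ?thesis
      by simp
  qed
  then show ?thesis
    using ennreal_le_epsilon[of 0 "packing_measure \<phi> s \<epsilon> Z"] by simp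
qed

lemma sum_le_packing_pre:
  fixes E :: "'a::metric_space set"
  assumes "finite E" "E \<subseteq> Z" "\<And>x. x \<in> E \<Longrightarrow> 0 < t x \<and> real N \<le> t x"
    and disj: "disjoint_family_on (\<lambda>x. rcball \<phi> x (t x) \<epsilon>) E"
  shows "(\<Sum>x\<in>E. ennreal (exp (- s * t x))) \<le> packing_pre \<phi> s \<epsilon> N Z"
proof -
  obtain h where h: "bij_betw h {0..<card E} E"
    using ex_bij_betw_nat_finite[OF assms(1)] by blast
  have "(\<Sum>x\<in>E. ennreal (exp (- s * t x))) = (\<Sum>\<^sub>\<infinity>i\<in>{0..<card E}. ennreal (exp (- s * t (h i))))"
    using sum.reindex_bij_betw[OF h, of "\<lambda>x. ennreal (exp (- s * t x))"] by simp
  also have "\<dots> \<le> packing_pre \<phi> s \<epsilon> N Z"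
    unfolding packing_pre_def
  proof (intro Sup_upper CollectI exI conjI)
    show "\<forall>i\<in>{0..<card E}. h i \<in> Z \<and> 0 < t (h i) \<and> real N \<le> t (h i)"
      using h assms(2,3) by (auto simp: bij_betw_def)
    show "disjoint_family_on (\<lambda>i. rcball \<phi> (h i) (t (h i)) \<epsilon>) {0..<card E}"
      using disj h unfolding disjoint_family_on_def bij_betw_def inj_on_def by (metis imageI)
  qed (rule refl)
  finally show ?thesis .
qed

text \<open>A nonnegative infinite sum is the supremum of its finite subsums, so a finite subfamily
  suffices. Disjoint balls contain their centers, which are therefore distinct and can replace the
  numbers as index set.\<close>

lemma less_packing_preE:
  fixes Z :: "'a::metric_space set"
  assumes "c < packing_pre \<phi> s \<epsilon> N Z" "0 \<le> \<epsilon>"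
  obtains E t where "finite E" "E \<subseteq> Z" "\<forall>x\<in>E. 0 < t x \<and> real N \<le> t x"
    "disjoint_family_on (\<lambda>x. rcball \<phi> x (t x) \<epsilon>) E" "c < (\<Sum>x\<in>E. ennreal (exp (- s * t x)))"
proof -
  from assms(1) obtain I x t where adm: "\<forall>i\<in>(I::nat set). x i \<in> Z \<and> 0 < t i \<and> real N \<le> t i"
    and disj: "disjoint_family_on (\<lambda>i. rcball \<phi> (x i) (t i) \<epsilon>) I"
    and c: "c < (\<Sum>\<^sub>\<infinity>i\<in>I. ennreal (exp (- s * t i)))"
    unfolding packing_pre_def less_Sup_iff by auto
  from c obtain F where F: "finite F" "F \<subseteq> I" "c < (\<Sum>i\<in>F. ennreal (exp (- s * t i)))"
    by (auto simp: nonneg_infsum_complete less_SUP_iff)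
  have inj: "inj_on x F"
  proof (rule inj_onI, rule ccontr)
    fix i j assume ij: "i \<in> F" "j \<in> F" "x i = x j" "i \<noteq> j"
    then have "rcball \<phi> (x i) (t i) \<epsilon> \<inter> rcball \<phi> (x j) (t j) \<epsilon> = {}"
      using F(2) by (intro disjoint_family_onD[OF disj]) auto
    then show False
      using center_in_rcball[OF assms(2)] ij(3) by (metis IntI empty_iff)
  qed
  define t' where "t' = t \<circ> the_inv_into F x"
  have t': "t' (x i) = t i" if "i \<in> F" for i
    using the_inv_into_f_f[OF inj that] by (simp add: t'_def)
  show thesis
  proof (rule that)
    show "finite (x ` F)" "x ` F \<subseteq> Z" "\<forall>y\<in>x ` F. 0 < t' y \<and> real N \<le> t' y"
      using F adm by (auto simp: t')
    show "disjoint_family_on (\<lambda>y. rcball \<phi> y (t' y) \<epsilon>) (x ` F)"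
      unfolding disjoint_family_on_def
    proof (intro ballI impI, elim imageE)
      fix y z i j assume "y \<noteq> z" "y = x i" "i \<in> F" "z = x j" "j \<in> F"
      then show "rcball \<phi> y (t' y) \<epsilon> \<inter> rcball \<phi> z (t' z) \<epsilon> = {}"
        using disjoint_family_onD[OF disj, of i j] F(2) by (auto simp: t')
    qed
    show "c < (\<Sum>y\<in>x ` F. ennreal (exp (- s * t' y)))"
      using F(3) by (simp add: sum.reindex[OF inj] t')
  qed
qed

section \<open>Limits in the radius as suprema\<close>

lemma tendsto_at_right_antimono:
  fixes f :: "real \<Rightarrow> ennreal"
  assumes "\<And>\<epsilon> \<epsilon>'. 0 < \<epsilon> \<Longrightarrow> \<epsilon> \<le> \<epsilon>' \<Longrightarrow> f \<epsilon>' \<le> f \<epsilon>"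
  shows "(f \<longlongrightarrow> (SUP \<epsilon>\<in>{0<..}. f \<epsilon>)) (at_right 0)"
proof (rule order_tendstoI)
  fix a assume "a < (SUP \<epsilon>\<in>{0<..}. f \<epsilon>)"
  then obtain \<epsilon> where "\<epsilon> > 0" "a < f \<epsilon>"
    by (auto simp: less_SUP_iff)
  then show "\<forall>\<^sub>F \<epsilon> in at_right 0. a < f \<epsilon>"
    using assms unfolding eventually_at_right_field by (meson less_le_trans less_imp_le)
next
  fix a assume a: "(SUP \<epsilon>\<in>{0<..}. f \<epsilon>) < a"
  have "f \<epsilon> < a" if "\<epsilon> > 0" for \<epsilon>
    using that by (intro le_less_trans[OF SUP_upper a]) auto
  then show "\<forall>\<^sub>F \<epsilon> in at_right 0. f \<epsilon> < a"
    unfolding eventually_at_right_field by (intro exI[of _ 1]) auto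
qed

lemma Lim_at_right_antimono:
  fixes f :: "real \<Rightarrow> ennreal"
  assumes "\<And>\<epsilon> \<epsilon>'. 0 < \<epsilon> \<Longrightarrow> \<epsilon> \<le> \<epsilon>' \<Longrightarrow> f \<epsilon>' \<le> f \<epsilon>"
  shows "Lim (at_right 0) f = (SUP \<epsilon>\<in>{0<..}. f \<epsilon>)"
  by (rule tendsto_Lim[OF _ tendsto_at_right_antimono[OF assms]]) auto

lemma packing_entropy_at_antimono:
  assumes "\<epsilon> \<le> \<epsilon>'"
  shows "packing_entropy_at \<phi> Z \<epsilon>' \<le> packing_entropy_at \<phi> Z \<epsilon>"
proof -
  have "packing_measure \<phi> s \<epsilon>' Z = 0" if "packing_measure \<phi> s \<epsilon> Z = 0" for s
    using packing_measure_mono[OF order_refl assms order_refl, of \<phi> s Z] that by simp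
  then show ?thesis
    unfolding packing_entropy_at_def by (intro Inf_superset_mono) blast
qed

lemma packing_entropy_eq_SUP: "packing_entropy \<phi> Z = (SUP \<epsilon>\<in>{0<..}. packing_entropy_at \<phi> Z \<epsilon>)"
  unfolding packing_entropy_def by (intro Lim_at_right_antimono packing_entropy_at_antimono)

lemma packing_measure_eq_0:
  assumes "packing_entropy_at \<phi> Z \<epsilon> < ennreal s"
  shows "packing_measure \<phi> s \<epsilon> Z = 0"
proof -
  obtain s' where s': "packing_measure \<phi> s' \<epsilon> Z = 0" "0 \<le> s'" "ennreal s' < ennreal s"
    using assms unfolding packing_entropy_at_def Inf_less_iff by auto
  then have "s' \<le> s"
    by (simp add: ennreal_less_iff)
  from packing_measure_mono[OF this order_refl order_refl, of \<phi> \<epsilon> Z] s'(1) show ?thesis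
    by simp
qed

lemma packing_measure_neq_0:
  assumes "ennreal s < packing_entropy_at \<phi> Z \<epsilon>" "0 \<le> s"
  shows "packing_measure \<phi> s \<epsilon> Z \<noteq> 0"
proof
  assume "packing_measure \<phi> s \<epsilon> Z = 0"
  then have "packing_entropy_at \<phi> Z \<epsilon> \<le> ennreal s"
    unfolding packing_entropy_at_def using assms(2) by (intro Inf_lower) blast
  then show False
    using assms(1) by simp
qed

lemma neg_log_antimono: "0 \<le> m \<Longrightarrow> m \<le> m' \<Longrightarrow> neg_log m' \<le> neg_log m"
  unfolding neg_log_def by (auto intro!: ennreal_leI)

lemma less_neg_log_divD:
  assumes "ennreal s < neg_log m / ennreal t" "0 \<le> s" "0 < t" "0 \<le> m"
  shows "m < exp (- s * t)"
proof (cases "m = 0")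
  case False
  \<comment> \<open>For \<open>m > 1\<close> the definition of \<open>neg_log\<close> truncates to
    0, which the strict lower bound excludes.\<close>
  have "ln m \<le> 0"
  proof (rule ccontr)
    assume "\<not> ln m \<le> 0"
    then have "neg_log m / ennreal t = 0"
      using False by (simp add: neg_log_def ennreal_neg)
    then show False
      using assms(1) by simp
  qed
  then have "ennreal s < ennreal (- ln m / t)"
    using assms False by (simp add: neg_log_def divide_ennreal)
  then have "s < - ln m / t"
    using assms(2) by (simp add: ennreal_less_iff)
  then have "ln m < - s * t"
    using assms(3) by (simp add: field_simps)
  then show ?thesis
    using False assms(4) by (metis exp_less_mono exp_ln order_le_less)
qed simp

lemma le_neg_log_divI:
  assumes "m \<le> exp (- s * t)" "0 \<le> s" "0 < t" "0 \<le> m"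
  shows "ennreal s \<le> neg_log m / ennreal t"
proof (cases "m = 0")
  case True
  then show ?thesis
    using assms by (simp add: neg_log_def ennreal_top_divide)
next
  case False
  then have "ln m \<le> - s * t"
    using assms by (metis exp_gt_zero ln_exp ln_mono order_le_less)
  then have "s \<le> - ln m / t"
    using assms(3) by (simp add: field_simps)
  moreover have "0 \<le> - ln m"
    using \<open>ln m \<le> - s * t\<close> assms(2,3) by (smt (verit) mult_minus_left mult_nonneg_nonneg)
  ultimately show ?thesis
    using False assms(3) by (simp add: neg_log_def divide_ennreal ennreal_leI)
qed

section \<open>Local entropy is bounded by packing entropy\<close>

text \<open>Cover the space by finitely many balls of radius \<open>d / 2\<close>: a separated set
  injects into their centers.\<close>

lemma finite_separated_card_bound:
  assumes "compact (UNIV :: 'a::metric_space set)" "d > 0"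
  obtains k where "\<forall>F :: 'a set. (\<forall>x\<in>F. \<forall>y\<in>F. dist x y < d \<longrightarrow> x = y) \<longrightarrow>
    finite F \<and> card F \<le> k"
proof -
  obtain C :: "'a set" where C: "finite C" "UNIV \<subseteq> (\<Union>c\<in>C. ball c (d / 2))"
    using assms unfolding compact_eq_totally_bounded by (meson half_gt_zero)
  then have "\<exists>c. c \<in> C \<and> dist c x < d / 2" for x
    using C(2) by (auto simp: subset_iff)
  then obtain c where c: "\<And>x. c x \<in> C" "\<And>x. dist (c x) x < d / 2"
    by metis
  show thesis
  proof (rule that[of "card C"], intro allI impI)
    fix F :: "'a set"
    assume sep: "\<forall>x\<in>F. \<forall>y\<in>F. dist x y < d \<longrightarrow> x = y"
    have "inj_on c F"
    proof (rule inj_onI)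
      fix x y assume "x \<in> F" "y \<in> F" "c x = c y"
      moreover from this have "dist x y < d"
        using c(2)[of x] c(2)[of y] dist_triangle_half_r by metis
      ultimately show "x = y"
        using sep by blast
    qed
    moreover have "c ` F \<subseteq> C"
      using c(1) by blast
    ultimately show "finite F \<and> card F \<le> card C"
      using C(1) by (simp add: inj_on_finite card_inj_on_le)
  qed
qed

context compact_flow
begin

lemma measure_rball_mono:
  assumes "\<mu> \<in> borel_prob_measures" "t \<le> t'" "\<epsilon> \<le> \<epsilon>'"
  shows "measure \<mu> (rball \<phi> x t' \<epsilon>) \<le> measure \<mu> (rball \<phi> x t \<epsilon>')"
proof -
  interpret \<mu>: prob_space \<mu>
    using assms(1) by (simp add: borel_prob_measures_def)
  have "sets \<mu> = sets borel"
    using assms(1) by (simp add: borel_prob_measures_def)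
  moreover have "rball \<phi> x t' \<epsilon> \<subseteq> rball \<phi> x t \<epsilon>'"
    using rball_antimono_time[OF assms(2)] rball_mono[OF assms(3)] by (rule subset_trans)
  ultimately show ?thesis
    by (intro \<mu>.finite_measure_mono) (simp_all add: open_rball)
qed

lemma upper_local_entropy_at_eq_SUP:
  assumes "\<mu> \<in> borel_prob_measures"
  shows "upper_local_entropy_at \<phi> \<mu> x =
    (SUP \<epsilon>\<in>{0<..}. Limsup at_top (\<lambda>t. neg_log (measure \<mu> (rball \<phi> x t \<epsilon>)) / ennreal t))"
  unfolding upper_local_entropy_at_def using assms
  by (intro Lim_at_right_antimono Limsup_mono always_eventually allI divide_right_mono_ennreal
      neg_log_antimono measure_rball_mono) auto

text \<open>Centers of disjoint balls are separated, so the size of packings is bounded and one of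
  greatest size exists. A point of \<open>E\<close> whose ball misses all the others could be added
  to it.\<close>

lemma finite_maximal_packing:
  assumes "\<epsilon> > 0"
  obtains F where "finite F" "F \<subseteq> E" "disjoint_family_on (\<lambda>x. rcball \<phi> x t \<epsilon>) F"
    "\<forall>y\<in>E. \<exists>x\<in>F. rcball \<phi> x t \<epsilon> \<inter> rcball \<phi> y t \<epsilon> \<noteq> {}"
proof -
  define P where "P F \<longleftrightarrow> F \<subseteq> E \<and> disjoint_family_on (\<lambda>x. rcball \<phi> x t \<epsilon>) F" for F
  have center: "x \<in> rcball \<phi> x t \<epsilon>" for x
    using assms by (simp add: center_in_rcball)
  obtain d where d: "d > 0" "\<And>x y. dist x y < d \<Longrightarrow> y \<in> rcball \<phi> x t \<epsilon>"
    using dist_less_in_rcball[OF assms] by blast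
  obtain k where k: "\<forall>F :: 'a set. (\<forall>x\<in>F. \<forall>y\<in>F. dist x y < d \<longrightarrow> x = y) \<longrightarrow>
      finite F \<and> card F \<le> k"
    by (rule finite_separated_card_bound[OF compact_UNIV d(1)])
  have bound: "finite F \<and> card F \<le> k" if "P F" for F
  proof (rule k[rule_format])
    fix x y assume xy: "x \<in> F" "y \<in> F" "dist x y < d"
    show "x = y"
    proof (rule ccontr)
      assume "x \<noteq> y"
      then have "rcball \<phi> x t \<epsilon> \<inter> rcball \<phi> y t \<epsilon> = {}"
        using \<open>P F\<close> xy(1,2) disjoint_family_onD unfolding P_def by metis
      then show False
        using d(2)[OF xy(3)] center by blast
    qed
  qed
  have "P {}"
    by (simp add: P_def disjoint_family_on_def)
  then obtain F where F: "P F" and max: "\<And>F'. P F' \<Longrightarrow> card F' \<le> card F"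
    using ex_has_greatest_nat[of P "{}" card "Suc k"] bound by (auto simp: less_Suc_eq_le)
  show thesis
  proof (rule that)
    show "finite F" "F \<subseteq> E" and disj: "disjoint_family_on (\<lambda>x. rcball \<phi> x t \<epsilon>) F"
      using F bound by (auto simp: P_def)
    show "\<forall>y\<in>E. \<exists>x\<in>F. rcball \<phi> x t \<epsilon> \<inter> rcball \<phi> y t \<epsilon> \<noteq> {}"
    proof
      fix y assume "y \<in> E"
      show "\<exists>x\<in>F. rcball \<phi> x t \<epsilon> \<inter> rcball \<phi> y t \<epsilon> \<noteq> {}"
      proof (rule ccontr)
        assume neg: "\<not> ?thesis"
        then have "y \<notin> F"
          using center by blast
        moreover have "P (insert y F)"
          using F \<open>y \<in> E\<close> neg \<open>y \<notin> F\<close> disj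
          by (auto simp: P_def disjoint_family_on_insert)
        ultimately show False
          using max[of "insert y F"] \<open>finite F\<close> by simp
      qed
    qed
  qed
qed

end

context fixed_point_free_flow
begin

section \<open>Covers of the points with small balls\<close>

context
  fixes \<kappa> \<epsilon> \<epsilon>' s s' :: real and \<mu> :: "'a measure"
  assumes \<kappa>: "\<kappa> > 1" and \<epsilon>': "\<epsilon>' > 0" and s: "\<kappa> * s' < s"
    and \<mu>: "\<mu> \<in> borel_prob_measures"
    and meet: "\<And>x y r. r \<ge> 1 \<Longrightarrow> rcball \<phi> x (\<kappa> * r) \<epsilon>' \<inter> rcball \<phi> y (\<kappa> * r) \<epsilon>' \<noteq> {} \<Longrightarrow>
      y \<in> rball \<phi> x r \<epsilon>"
begin

text \<open>Around a maximal packing of time \<open>\<kappa> * n\<close>, the open balls of time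
  \<open>n\<close> cover, since every further ball meets a chosen one. Each has mass below
  \<open>exp (- s * n)\<close>, which is \<open>exp (\<kappa> * s' - s) ^ n\<close> times the weight
  \<open>exp (- s' * (\<kappa> * n))\<close> of its packing ball.\<close>

lemma small_balls_cover_level:
  assumes "n \<ge> 1" "N \<le> n"
  obtains U where "open U" "{x \<in> Z. measure \<mu> (rball \<phi> x (real n) \<epsilon>) < exp (- s * real n)} \<subseteq> U"
    "emeasure \<mu> U \<le> ennreal (exp (\<kappa> * s' - s) ^ n) * packing_pre \<phi> s' \<epsilon>' N Z"
proof -
  interpret \<mu>: prob_space \<mu>
    using \<mu> by (simp add: borel_prob_measures_def)
  have sets[simp]: "sets \<mu> = sets borel"
    using \<mu> by (simp add: borel_prob_measures_def)
  let ?E = "{x \<in> Z. measure \<mu> (rball \<phi> x (real n) \<epsilon>) < exp (- s * real n)}"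
  obtain F where F: "finite F" "F \<subseteq> ?E" "disjoint_family_on (\<lambda>x. rcball \<phi> x (\<kappa> * real n) \<epsilon>') F"
    and max: "\<forall>y\<in>?E. \<exists>x\<in>F. rcball \<phi> x (\<kappa> * real n) \<epsilon>' \<inter> rcball \<phi> y (\<kappa> * real n) \<epsilon>' \<noteq> {}"
    by (rule finite_maximal_packing[OF \<epsilon>'])
  have "real n \<le> \<kappa> * real n"
    using \<kappa> by (simp add: mult_le_cancel_right1)
  moreover have "0 < real n" "real N \<le> real n"
    using assms by auto
  ultimately have time: "0 < \<kappa> * real n" "real N \<le> \<kappa> * real n"
    by linarith+
  show thesis
  proof (rule that)
    show "open (\<Union>x\<in>F. rball \<phi> x (real n) \<epsilon>)"
      using open_rball by blast
    show "?E \<subseteq> (\<Union>x\<in>F. rball \<phi> x (real n) \<epsilon>)"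
    proof
      fix y assume "y \<in> ?E"
      then obtain x where "x \<in> F" "rcball \<phi> x (\<kappa> * real n) \<epsilon>' \<inter> rcball \<phi> y (\<kappa> * real n) \<epsilon>' \<noteq> {}"
        using max by blast
      then show "y \<in> (\<Union>x\<in>F. rball \<phi> x (real n) \<epsilon>)"
        using meet[of "real n" x y] assms(1) by auto
    qed
    have "emeasure \<mu> (\<Union>x\<in>F. rball \<phi> x (real n) \<epsilon>) \<le> (\<Sum>x\<in>F. emeasure \<mu> (rball \<phi> x (real n) \<epsilon>))"
      using F(1) open_rball by (intro emeasure_subadditive_finite) auto
    also have "\<dots> \<le> (\<Sum>x\<in>F. ennreal (exp (- s * real n)))"
      using F(2) by (intro sum_mono) (auto simp: \<mu>.emeasure_eq_measure intro!: ennreal_leI)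
    also have "\<dots> = (\<Sum>x\<in>F. ennreal (exp (\<kappa> * s' - s) ^ n) * ennreal (exp (- s' * (\<kappa> * real n))))"
      by (simp add: algebra_simps flip: ennreal_mult exp_of_nat_mult exp_add)
    also have "\<dots> = ennreal (exp (\<kappa> * s' - s) ^ n) * (\<Sum>x\<in>F. ennreal (exp (- s' * (\<kappa> * real n))))"
      by (simp only: sum_distrib_left)
    also have "\<dots> \<le> ennreal (exp (\<kappa> * s' - s) ^ n) * packing_pre \<phi> s' \<epsilon>' N Z"
      using F time by (intro mult_left_mono sum_le_packing_pre) auto
    finally show "emeasure \<mu> (\<Union>x\<in>F. rball \<phi> x (real n) \<epsilon>)
      \<le> ennreal (exp (\<kappa> * s' - s) ^ n) * packing_pre \<phi> s' \<epsilon>' N Z" .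
  qed
qed

lemma small_balls_cover:
  assumes "N \<ge> 1"
  obtains U where "open U"
    "{x \<in> Z. \<exists>n\<ge>N. measure \<mu> (rball \<phi> x (real n) \<epsilon>) < exp (- s * real n)} \<subseteq> U"
    "emeasure \<mu> U \<le> ennreal (1 / (1 - exp (\<kappa> * s' - s))) * packing_pre \<phi> s' \<epsilon>' N Z"
proof -
  define q where "q = exp (\<kappa> * s' - s)"
  have q: "0 < q" "q < 1"
    using s by (auto simp: q_def)
  \<comment> \<open>Levels below \<open>N\<close> get the empty set, so the geometric series can run
    over all \<open>n\<close>.\<close>
  have "\<exists>V. open V \<and> (n \<ge> N \<longrightarrow> {x \<in> Z. measure \<mu> (rball \<phi> x (real n) \<epsilon>) < exp (- s * real n)} \<subseteq> V) \<and>
      emeasure \<mu> V \<le> ennreal (q ^ n) * packing_pre \<phi> s' \<epsilon>' N Z" for n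
  proof (cases "n \<ge> N")
    case True
    then have "n \<ge> 1"
      using assms by simp
    obtain U where "open U" "{x \<in> Z. measure \<mu> (rball \<phi> x (real n) \<epsilon>) < exp (- s * real n)} \<subseteq> U"
      "emeasure \<mu> U \<le> ennreal (q ^ n) * packing_pre \<phi> s' \<epsilon>' N Z"
      unfolding q_def by (rule small_balls_cover_level[OF \<open>n \<ge> 1\<close> True])
    then show ?thesis
      by (intro exI[of _ U] conjI impI)
  next
    case False
    then show ?thesis
      by (intro exI[of _ "{}"]) simp
  qed
  then have "\<forall>n. \<exists>V. open V \<and>
      (n \<ge> N \<longrightarrow> {x \<in> Z. measure \<mu> (rball \<phi> x (real n) \<epsilon>) < exp (- s * real n)} \<subseteq> V) \<and>
      emeasure \<mu> V \<le> ennreal (q ^ n) * packing_pre \<phi> s' \<epsilon>' N Z" ..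
  from choice[OF this] obtain V where V: "open (V n)"
    "n \<ge> N \<Longrightarrow> {x \<in> Z. measure \<mu> (rball \<phi> x (real n) \<epsilon>) < exp (- s * real n)} \<subseteq> V n"
    "emeasure \<mu> (V n) \<le> ennreal (q ^ n) * packing_pre \<phi> s' \<epsilon>' N Z" for n
    by auto
  have "range V \<subseteq> sets \<mu>"
    using V(1) \<mu> by (auto simp: borel_prob_measures_def)
  then have "emeasure \<mu> (\<Union>n. V n) \<le> (\<Sum>n. emeasure \<mu> (V n))"
    by (rule emeasure_subadditive_countably)
  also have "\<dots> \<le> (\<Sum>n. ennreal (q ^ n) * packing_pre \<phi> s' \<epsilon>' N Z)"
    by (intro suminf_le V(3)) auto
  also have "\<dots> = (\<Sum>n. ennreal (q ^ n)) * packing_pre \<phi> s' \<epsilon>' N Z"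
    by (rule ennreal_suminf_multc)
  also have "(\<Sum>n. ennreal (q ^ n)) = ennreal (1 / (1 - q))"
    using q geometric_sums[of q] by (intro suminf_ennreal_eq) auto
  finally have "emeasure \<mu> (\<Union>n. V n) \<le> ennreal (1 / (1 - q)) * packing_pre \<phi> s' \<epsilon>' N Z" .
  moreover have "{x \<in> Z. \<exists>n\<ge>N. measure \<mu> (rball \<phi> x (real n) \<epsilon>) < exp (- s * real n)} \<subseteq> (\<Union>n. V n)"
  proof
    fix x assume "x \<in> {x \<in> Z. \<exists>n\<ge>N. measure \<mu> (rball \<phi> x (real n) \<epsilon>) < exp (- s * real n)}"
    then obtain n where "n \<ge> N" "x \<in> Z" "measure \<mu> (rball \<phi> x (real n) \<epsilon>) < exp (- s * real n)"
      by blast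
    then have "x \<in> V n"
      using V(2)[of n] by auto
    then show "x \<in> (\<Union>n. V n)"
      by blast
  qed
  moreover have "open (\<Union>n. V n)"
    using V(1) by blast
  ultimately show thesis
    using that unfolding q_def by blast
qed

text \<open>A piece \<open>Zs i\<close> of a cheap cover has its own threshold \<open>N i\<close>,
  beyond which its packing sums are almost at their limit. A point that has small balls infinitely
  often has one at some \<open>n \<ge> N i\<close>, so the covers of single pieces suffice; their
  total is at most \<open>C * (2 * \<theta>) = \<eta>\<close>.\<close>

lemma small_balls_null:
  assumes null: "packing_measure \<phi> s' \<epsilon>' Z = 0" and "\<eta> > 0"
  obtains U where "open U"
    "{x \<in> Z. \<exists>\<^sub>\<infinity>n. measure \<mu> (rball \<phi> x (real n) \<epsilon>) < exp (- s * real n)} \<subseteq> U"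
    "emeasure \<mu> U \<le> ennreal \<eta>"
proof -
  define C where "C = 1 / (1 - exp (\<kappa> * s' - s))"
  have "C > 0"
    using s by (simp add: C_def)
  define \<theta> where "\<theta> = \<eta> / (2 * C)"
  have "\<theta> > 0" and \<theta>: "C * (2 * \<theta>) = \<eta>"
    using \<open>C > 0\<close> \<open>\<eta> > 0\<close> by (auto simp: \<theta>_def)
  obtain Zs :: "nat \<Rightarrow> 'a set" where Zs: "Z \<subseteq> (\<Union>i. Zs i)"
    "(\<Sum>i. packing_lim \<phi> s' \<epsilon>' (Zs i)) < ennreal \<theta>"
    using packing_measure_lessE[of \<phi> s' \<epsilon>' Z "ennreal \<theta>"] null \<open>\<theta> > 0\<close> by auto
  have "\<exists>N\<ge>1. packing_pre \<phi> s' \<epsilon>' N (Zs i) \<le> packing_lim \<phi> s' \<epsilon>' (Zs i) + ennreal (\<theta> * (1 / 2) ^ Suc i)"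
    for i
  proof -
    \<comment> \<open>Finiteness makes adding a positive amount a strict increase, so some
      \<open>N\<close> lies below it.\<close>
    have "packing_lim \<phi> s' \<epsilon>' (Zs i) < \<infinity>"
      using Zs(2) by (metis ennreal_less_top ennreal_suminf_lessD infinity_ennreal_def less_trans)
    moreover have "0 < ennreal (\<theta> * (1 / 2) ^ Suc i)"
      using \<open>\<theta> > 0\<close> by simp
    ultimately have "packing_lim \<phi> s' \<epsilon>' (Zs i) < packing_lim \<phi> s' \<epsilon>' (Zs i) + ennreal (\<theta> * (1 / 2) ^ Suc i)"
      by (simp add: ennreal_add_left_cancel_less)
    then obtain N where "packing_pre \<phi> s' \<epsilon>' N (Zs i)
        < packing_lim \<phi> s' \<epsilon>' (Zs i) + ennreal (\<theta> * (1 / 2) ^ Suc i)"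
      unfolding packing_lim_eq_INF INF_less_iff by auto
    moreover have "packing_pre \<phi> s' \<epsilon>' (Suc N) (Zs i) \<le> packing_pre \<phi> s' \<epsilon>' N (Zs i)"
      by (simp add: packing_pre_mono)
    ultimately show ?thesis
      by (intro exI[of _ "Suc N"]) auto
  qed
  then obtain N where N: "\<And>i. N i \<ge> 1"
    "\<And>i. packing_pre \<phi> s' \<epsilon>' (N i) (Zs i) \<le> packing_lim \<phi> s' \<epsilon>' (Zs i) + ennreal (\<theta> * (1 / 2) ^ Suc i)"
    by metis
  have "\<forall>i. \<exists>U. open U \<and>
      {x \<in> Zs i. \<exists>n\<ge>N i. measure \<mu> (rball \<phi> x (real n) \<epsilon>) < exp (- s * real n)} \<subseteq> U \<and>
      emeasure \<mu> U \<le> ennreal C * packing_pre \<phi> s' \<epsilon>' (N i) (Zs i)"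
    unfolding C_def by (rule allI, rule small_balls_cover[OF N(1)]) blast
  from choice[OF this] obtain U where U: "open (U i)"
    "{x \<in> Zs i. \<exists>n\<ge>N i. measure \<mu> (rball \<phi> x (real n) \<epsilon>) < exp (- s * real n)} \<subseteq> U i"
    "emeasure \<mu> (U i) \<le> ennreal C * packing_pre \<phi> s' \<epsilon>' (N i) (Zs i)" for i
    by auto
  show thesis
  proof (rule that)
    show "open (\<Union>i. U i)"
      using U(1) by blast
    show "{x \<in> Z. \<exists>\<^sub>\<infinity>n. measure \<mu> (rball \<phi> x (real n) \<epsilon>) < exp (- s * real n)} \<subseteq> (\<Union>i. U i)"
    proof
      fix x assume x: "x \<in> {x \<in> Z. \<exists>\<^sub>\<infinity>n. measure \<mu> (rball \<phi> x (real n) \<epsilon>) < exp (- s * real n)}"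
      then obtain i where "x \<in> Zs i"
        using Zs(1) by blast
      moreover have "\<exists>n\<ge>N i. measure \<mu> (rball \<phi> x (real n) \<epsilon>) < exp (- s * real n)"
        using x unfolding INFM_nat_le by blast
      ultimately have "x \<in> U i"
        using U(2)[of i] by blast
      then show "x \<in> (\<Union>i. U i)"
        by blast
    qed
    have "range U \<subseteq> sets \<mu>"
      using U(1) \<mu> by (auto simp: borel_prob_measures_def)
    then have "emeasure \<mu> (\<Union>i. U i) \<le> (\<Sum>i. emeasure \<mu> (U i))"
      by (rule emeasure_subadditive_countably)
    also have "\<dots> \<le> (\<Sum>i. ennreal C * (packing_lim \<phi> s' \<epsilon>' (Zs i) + ennreal (\<theta> * (1 / 2) ^ Suc i)))"
      by (intro suminf_le order_trans[OF U(3)] mult_left_mono N(2)) auto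
    also have "\<dots> = ennreal C * ((\<Sum>i. packing_lim \<phi> s' \<epsilon>' (Zs i)) + (\<Sum>i. ennreal (\<theta> * (1 / 2) ^ Suc i)))"
      by (simp only: ennreal_suminf_cmult suminf_add[OF summableI summableI])
    also have "\<dots> \<le> ennreal C * (ennreal \<theta> + ennreal \<theta>)"
      using Zs(2) \<open>\<theta> > 0\<close> by (intro mult_left_mono add_mono) (simp_all only: suminf_half_powers less_imp_le order_refl zero_le)
    also have "\<dots> = ennreal \<eta>"
      using \<theta> \<open>\<theta> > 0\<close> \<open>C > 0\<close> by (simp flip: ennreal_plus ennreal_mult)
    finally show "emeasure \<mu> (\<Union>i. U i) \<le> ennreal \<eta>" .
  qed
qed

end

text \<open>Passes from real to integer times: rounding \<open>t\<close> up shrinks the ball, and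
  the change of exponent from \<open>s\<close> to \<open>s'\<close> pays for the rounding once
  \<open>(s - s') * t > s\<close>.\<close>

lemma frequently_small_balls:
  assumes \<mu>: "\<mu> \<in> borel_prob_measures" and "0 \<le> s'" "s' < s"
    and limsup: "ennreal s < Limsup at_top (\<lambda>t. neg_log (measure \<mu> (rball \<phi> x t \<epsilon>)) / ennreal t)"
  shows "\<exists>\<^sub>\<infinity>n. measure \<mu> (rball \<phi> x (real n) \<epsilon>) < exp (- s' * real n)"
  unfolding INFM_nat_le
proof
  fix m :: nat
  define T where "T = max (real m) (s / (s - s')) + 1"
  have "\<exists>t\<ge>T. ennreal s < neg_log (measure \<mu> (rball \<phi> x t \<epsilon>)) / ennreal t"
  proof (rule ccontr)
    assume "\<not> ?thesis"
    then have "\<forall>\<^sub>F t in at_top. neg_log (measure \<mu> (rball \<phi> x t \<epsilon>)) / ennreal t \<le> ennreal s"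
      unfolding eventually_at_top_linorder by (meson not_le)
    then have "Limsup at_top (\<lambda>t. neg_log (measure \<mu> (rball \<phi> x t \<epsilon>)) / ennreal t) \<le> ennreal s"
      by (rule Limsup_bounded)
    then show False
      using limsup by simp
  qed
  then obtain t where t: "t \<ge> T" "ennreal s < neg_log (measure \<mu> (rball \<phi> x t \<epsilon>)) / ennreal t"
    by blast
  have "t > 0" "t \<ge> real m" "s / (s - s') < t"
    using t(1) by (auto simp: T_def)
  define n where "n = nat \<lceil>t\<rceil>"
  have n: "t \<le> real n" "real n < t + 1"
    using \<open>t > 0\<close> by (auto simp: n_def ceiling_correct) linarith+
  have "measure \<mu> (rball \<phi> x (real n) \<epsilon>) \<le> measure \<mu> (rball \<phi> x t \<epsilon>)"
    using \<mu> n(1) by (intro measure_rball_mono) auto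
  also have "\<dots> < exp (- s * t)"
    using t(2) assms(2,3) \<open>t > 0\<close> by (intro less_neg_log_divD) auto
  also have "\<dots> \<le> exp (- s' * real n)"
  proof -
    have "s < (s - s') * t"
      using \<open>s / (s - s') < t\<close> assms(3) by (simp add: field_simps)
    moreover have "s' * real n \<le> s' * (t + 1)"
      using n(2) assms(2) by (intro mult_left_mono) auto
    ultimately show ?thesis
      using assms(3) by (simp add: algebra_simps)
  qed
  finally show "\<exists>n\<ge>m. measure \<mu> (rball \<phi> x (real n) \<epsilon>) < exp (- s' * real n)"
    using n(1) \<open>t \<ge> real m\<close> by (intro exI[of _ n]) auto
qed

text \<open>A supposed gap between the two sides is filled with \<open>s1 < s2 < s\<close>:
  \<open>s\<close> cuts out the set \<open>A\<close> of positive mass, \<open>s2\<close> is what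
  remains after rounding times to integers, and \<open>s1\<close>, with
  \<open>\<kappa> * s1 < s2\<close>, is an exponent of null packing measure.\<close>

lemma upper_local_entropy_le_packing_entropy:
  assumes \<mu>: "\<mu> \<in> borel_prob_measures" and K: "K \<in> sets borel" "measure \<mu> K = 1"
  shows "upper_local_entropy \<phi> \<mu> \<le> packing_entropy \<phi> K"
proof (rule ccontr)
  interpret \<mu>: prob_space \<mu>
    using \<mu> by (simp add: borel_prob_measures_def)
  have sets[simp]: "sets \<mu> = sets borel"
    using \<mu> by (simp add: borel_prob_measures_def)
  then have space[simp]: "space \<mu> = UNIV"
    using sets_eq_imp_space_eq by fastforce
  let ?h = "upper_local_entropy_at \<phi> \<mu>"
  assume "\<not> ?thesis"
  then have "packing_entropy \<phi> K < (\<integral>\<^sup>+ x. ?h x \<partial>\<mu>)"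
    by (simp add: upper_local_entropy_def)
  \<comment> \<open>The integral is by definition a supremum over simple functions below
    \<open>?h\<close>, so \<open>g\<close> supplies the measurability.\<close>
  then obtain g where g: "simple_function \<mu> g" "g \<le> ?h" "packing_entropy \<phi> K < integral\<^sup>S \<mu> g"
    unfolding nn_integral_def less_SUP_iff by auto
  obtain c where c: "packing_entropy \<phi> K < c" "c < integral\<^sup>S \<mu> g"
    using dense g(3) by blast
  then obtain s where s: "c = ennreal s" "0 \<le> s"
    by (cases c) auto
  obtain b where b: "packing_entropy \<phi> K < b" "b < c"
    using dense c(1) by blast
  then obtain s2 where s2: "b = ennreal s2" "0 \<le> s2"
    by (cases b) auto
  obtain a where a: "packing_entropy \<phi> K < a" "a < b"
    using dense b(1) by blast
  then obtain s1 where s1: "a = ennreal s1" "0 \<le> s1"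
    by (cases a) auto
  have "s1 < s2" "s2 < s"
    using a b s s1 s2 by (auto simp: ennreal_less_iff)
  define A where "A = {x \<in> K. ennreal s < g x}"
  have g_meas: "g \<in> borel_measurable \<mu>"
    using g(1) by (rule borel_measurable_simple_function)
  have A_sets: "A \<in> sets \<mu>"
  proof -
    have "{x \<in> space \<mu>. ennreal s < g x} \<in> sets \<mu>"
      using g_meas by measurable
    then have "K \<inter> {x. ennreal s < g x} \<in> sets \<mu>"
      using K(1) by auto
    then show ?thesis
      by (simp add: A_def Int_def)
  qed
  have "emeasure \<mu> A \<noteq> 0"
  proof
    assume "emeasure \<mu> A = 0"
    then have "AE x in \<mu>. x \<notin> A"
      using A_sets by (intro AE_not_in) (auto simp: null_sets_def)
    moreover have "AE x in \<mu>. x \<in> K"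
      using \<mu>.AE_in_set_eq_1[of K] K by simp
    ultimately have "AE x in \<mu>. g x \<le> ennreal s"
      by eventually_elim (auto simp: A_def)
    then have "(\<integral>\<^sup>+ x. g x \<partial>\<mu>) \<le> (\<integral>\<^sup>+ x. ennreal s \<partial>\<mu>)"
      by (rule nn_integral_mono_AE)
    then have "integral\<^sup>S \<mu> g \<le> ennreal s"
      by (simp add: nn_integral_eq_simple_integral[OF g(1)] \<mu>.emeasure_space_1[simplified])
    then show False
      using c(2) s(1) by simp
  qed
  obtain \<kappa> where \<kappa>: "\<kappa> > 1" "\<kappa> * s1 < s2"
  proof (cases "s1 = 0")
    case True
    then show thesis
      using that[of 2] \<open>s1 < s2\<close> by simp
  next
    case False
    then have "1 < s2 / s1"
      using \<open>s1 < s2\<close> s1(2) by simp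
    then obtain k where "1 < k" "k < s2 / s1"
      using dense by blast
    then show thesis
      using that[of k] False s1(2) by (simp add: field_simps)
  qed
  obtain \<epsilon>0 where \<epsilon>0: "\<epsilon>0 > 0"
    "\<And>\<epsilon> \<epsilon>' x y r. 2 * \<epsilon>' < \<epsilon> \<Longrightarrow> \<epsilon>' \<le> \<epsilon>0 \<Longrightarrow> r \<ge> 1 \<Longrightarrow>
      rcball \<phi> x (\<kappa> * r) \<epsilon>' \<inter> rcball \<phi> y (\<kappa> * r) \<epsilon>' \<noteq> {} \<Longrightarrow> y \<in> rball \<phi> x r \<epsilon>"
    using meeting_rcballs[OF \<kappa>(1)] by metis
  \<comment> \<open>A sequence tending to 0; the factor 3 makes \<open>\<epsilon> m\<close> exceed
    twice the radius \<open>\<epsilon>0 / real (Suc m)\<close> used for the packings.\<close>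
  define \<epsilon> where "\<epsilon> m = 3 * \<epsilon>0 / real (Suc m)" for m
  define B where "B m = {x \<in> K. \<exists>\<^sub>\<infinity>n. measure \<mu> (rball \<phi> x (real n) (\<epsilon> m)) < exp (- s2 * real n)}" for m
  have A_sub: "A \<subseteq> (\<Union>m. B m)"
  proof
    fix x assume "x \<in> A"
    then have "ennreal s < ?h x"
      using g(2) by (auto simp: A_def le_fun_def intro: less_le_trans)
    then obtain e where e: "e > 0"
      "ennreal s < Limsup at_top (\<lambda>t. neg_log (measure \<mu> (rball \<phi> x t e)) / ennreal t)"
      unfolding upper_local_entropy_at_eq_SUP[OF \<mu>] by (auto simp: less_SUP_iff)
    obtain m where "3 * \<epsilon>0 / e < real (Suc m)"
      using reals_Archimedean2 by (metis less_trans lessI of_nat_less_iff)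
    then have "\<epsilon> m \<le> e"
      using e(1) by (simp add: \<epsilon>_def field_simps)
    have "\<exists>\<^sub>\<infinity>n. measure \<mu> (rball \<phi> x (real n) e) < exp (- s2 * real n)"
      by (rule frequently_small_balls[OF \<mu> s2(2) \<open>s2 < s\<close> e(2)])
    then have "\<exists>\<^sub>\<infinity>n. measure \<mu> (rball \<phi> x (real n) (\<epsilon> m)) < exp (- s2 * real n)"
      by (rule INFM_mono) (rule le_less_trans[OF measure_rball_mono[OF \<mu> order_refl \<open>\<epsilon> m \<le> e\<close>]])
    then show "x \<in> (\<Union>m. B m)"
      using \<open>x \<in> A\<close> by (auto simp: B_def A_def)
  qed
  have small: "\<exists>U. open U \<and> B m \<subseteq> U \<and> emeasure \<mu> U \<le> ennreal \<eta>" if "\<eta> > 0" for m \<eta>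
  proof -
    define \<epsilon>' where "\<epsilon>' = \<epsilon>0 / real (Suc m)"
    have \<epsilon>': "\<epsilon>' > 0" "2 * \<epsilon>' < \<epsilon> m" "\<epsilon>' \<le> \<epsilon>0"
      using \<epsilon>0(1) by (auto simp: \<epsilon>'_def \<epsilon>_def field_simps intro!: add_pos_nonneg)
    have "packing_entropy_at \<phi> K \<epsilon>' \<le> packing_entropy \<phi> K"
      unfolding packing_entropy_eq_SUP using \<epsilon>'(1) by (intro SUP_upper) simp
    then have null: "packing_measure \<phi> s1 \<epsilon>' K = 0"
      using a(1) s1(1) by (intro packing_measure_eq_0) (simp add: le_less_trans)
    show ?thesis
      unfolding B_def
      by (rule small_balls_null[OF \<kappa>(1) \<epsilon>'(1) \<kappa>(2) \<mu> \<epsilon>0(2)[OF \<epsilon>'(2,3)] null that]) blast+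
  qed
  have "emeasure \<mu> A \<le> 0 + ennreal \<eta>" if "\<eta> > 0" for \<eta>
  proof -
    have "\<exists>U. open U \<and> B m \<subseteq> U \<and> emeasure \<mu> U \<le> ennreal (\<eta> * (1 / 2) ^ Suc m)" for m
      using that by (intro small) simp
    then obtain U where U: "\<And>m. open (U m)" "\<And>m. B m \<subseteq> U m"
      "\<And>m. emeasure \<mu> (U m) \<le> ennreal (\<eta> * (1 / 2) ^ Suc m)"
      by metis
    have U_sets: "range U \<subseteq> sets \<mu>"
      using U(1) by auto
    have "emeasure \<mu> A \<le> emeasure \<mu> (\<Union>m. U m)"
      using A_sub U(2) U_sets by (intro emeasure_mono) blast+
    also have "\<dots> \<le> (\<Sum>m. emeasure \<mu> (U m))"
      using U_sets by (rule emeasure_subadditive_countably)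
    also have "\<dots> \<le> (\<Sum>m. ennreal (\<eta> * (1 / 2) ^ Suc m))"
      by (intro suminf_le U(3)) auto
    also have "\<dots> = ennreal \<eta>"
      using that by (simp only: suminf_half_powers less_imp_le)
    finally show ?thesis
      by simp
  qed
  then have "emeasure \<mu> A \<le> 0"
    using ennreal_le_epsilon[of 0 "emeasure \<mu> A"] by simp
  then show False
    using \<open>emeasure \<mu> A \<noteq> 0\<close> by simp
qed

end

section \<open>Measures of large local entropy\<close>

text \<open>The mass of \<open>A\<close> within \<open>{0..c}\<close> is 1-Lipschitz in
  \<open>c\<close>, so it takes the value \<open>w\<close> by the intermediate value
  theorem.\<close>

lemma unit_interval_divisible:
  fixes w :: real
  defines "M \<equiv> restrict_space lborel {0..1::real}"
  assumes A: "A \<in> sets M" and w: "0 \<le> w" "w \<le> measure M A"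
  obtains B where "B \<in> sets M" "B \<subseteq> A" "measure M B = w"
proof -
  have M: "measure M S = measure lborel S" if "S \<in> sets M" for S
    using that unfolding M_def
    by (intro measure_restrict_space) (auto simp: sets_restrict_space)
  have A': "A \<in> sets borel" "A \<subseteq> {0..1}"
    using A by (auto simp: M_def sets_restrict_space)
  have inM: "A \<inter> {0..c} \<in> sets M" for c
    using A' unfolding M_def by (subst sets_restrict_space_iff) auto
  define F where "F c = measure lborel (A \<inter> {0..c})" for c
  have fin: "A \<inter> S \<in> fmeasurable lborel" if "S \<in> sets borel" for S
    by (rule fmeasurableI2[of "{0..1}"]) (use A' that in \<open>auto simp: fmeasurable_def\<close>)
  have "0 \<le> F d - F c \<and> F d - F c \<le> d - c" if "c \<le> d" for c d
  proof -
    have "F c \<le> F d"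
      unfolding F_def using that A' by (intro measure_mono_fmeasurable fin) auto
    have "F d \<le> measure lborel ((A \<inter> {0..c}) \<union> {c..d})"
      unfolding F_def using that A' fin[of "{0..c}"]
      by (intro measure_mono_fmeasurable fmeasurable.Un) (auto simp: fmeasurable_def)
    also have "\<dots> \<le> F c + measure lborel {c..d}"
      unfolding F_def using A' by (intro measure_Un_le) auto
    finally show ?thesis
      using \<open>F c \<le> F d\<close> that by simp
  qed
  then have "\<bar>F d - F c\<bar> \<le> \<bar>d - c\<bar>" for c d
    by (smt (verit, best))
  then have "continuous_on {0..1} F"
    by (intro continuous_on_iff[THEN iffD2]) (metis dist_real_def le_less_trans)
  moreover have "F 0 \<le> w"
  proof -
    have "F 0 \<le> measure lborel {0::real}"
      unfolding F_def using A' by (intro measure_mono_fmeasurable) (auto simp: fmeasurable_def)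
    then show ?thesis
      using w by simp
  qed
  moreover have "w \<le> F 1"
    using w(2) A' M[OF A] by (simp add: F_def Int_absorb2)
  ultimately obtain c where "F c = w"
    using IVT'[of F 0 w 1] by auto
  then show thesis
    using that[of "A \<inter> {0..c}"] inM M[OF inM] by (simp add: F_def)
qed

text \<open>Greedy filling: \<open>y\<close> takes a part of mass
  \<open>min (w y) (measure M A)\<close>, and the remaining capacities still suffice for the rest of
  \<open>A\<close>. The last point takes all that is left. Parts may be empty.\<close>

lemma (in finite_measure) distribute_measure:
  fixes w :: "'b \<Rightarrow> real"
  assumes divisible: "\<And>A v. A \<in> sets M \<Longrightarrow> 0 \<le> v \<Longrightarrow> v \<le> measure M A \<Longrightarrow>
      \<exists>B\<in>sets M. B \<subseteq> A \<and> measure M B = v"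
    and "finite E" "E \<noteq> {}" "A \<in> sets M" "\<And>y. y \<in> E \<Longrightarrow> 0 \<le> w y" "measure M A \<le> sum w E"
  shows "\<exists>g. (\<forall>u. g u \<in> E) \<and>
    (\<forall>y\<in>E. A \<inter> g -` {y} \<in> sets M \<and> measure M (A \<inter> g -` {y}) \<le> w y)"
  using assms(2-)
proof (induction E arbitrary: A rule: finite_ne_induct)
  case (singleton y)
  then show ?case
    by (intro exI[of _ "\<lambda>_. y"]) simp
next
  case (insert y E)
  have "0 \<le> min (w y) (measure M A)"
    using insert.prems(2) by simp
  then obtain B where B: "B \<in> sets M" "B \<subseteq> A" "measure M B = min (w y) (measure M A)"
    using divisible[OF insert.prems(1), of "min (w y) (measure M A)"] by auto
  have "0 \<le> sum w E"
    using insert.prems(2) by (intro sum_nonneg) simp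
  then have "measure M (A - B) \<le> sum w E"
    using finite_measure_Diff[OF insert.prems(1) B(1,2)] B(3) insert.prems(3) insert.hyps
    by (auto simp: min_def split: if_splits)
  moreover have "A - B \<in> sets M"
    using B(1) insert.prems(1) by simp
  ultimately obtain g where g: "\<forall>u. g u \<in> E"
    "\<forall>z\<in>E. (A - B) \<inter> g -` {z} \<in> sets M \<and> measure M ((A - B) \<inter> g -` {z}) \<le> w z"
    using insert.IH[of "A - B"] insert.prems(2) by auto
  define g' where "g' u = (if u \<in> B then y else g u)" for u
  have "A \<inter> g' -` {y} = B"
    using g(1) insert.hyps B(2) by (auto simp: g'_def split: if_splits)
  moreover have "A \<inter> g' -` {z} = (A - B) \<inter> g -` {z}" if "z \<in> E" for z
    using that insert.hyps by (auto simp: g'_def split: if_splits)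
  ultimately have "A \<inter> g' -` {z} \<in> sets M \<and> measure M (A \<inter> g' -` {z}) \<le> w z" if "z \<in> insert y E" for z
    using g(2) B(1,3) that by (cases "z = y") auto
  moreover have "g' u \<in> insert y E" for u
    using g(1) by (simp add: g'_def)
  ultimately show ?case
    by blast
qed

section \<open>Nonnull packing measure and packings of infinite weight\<close>

lemma packing_measure_null_countable:
  assumes "countable \<A>" "\<And>A. A \<in> \<A> \<Longrightarrow> packing_measure \<phi> s \<epsilon> A = 0" "Z \<subseteq> \<Union>\<A>"
  shows "packing_measure \<phi> s \<epsilon> Z = 0"
proof -
  have empty: "packing_measure \<phi> s \<epsilon> {} = 0"
    using packing_measure_le_packing_lim[of \<phi> s \<epsilon> "{}"] by simp
  let ?A = "from_nat_into (insert {} \<A>)"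
  have range: "range ?A = insert {} \<A>"
    using assms(1) by (intro range_from_nat_into) auto
  show ?thesis
  proof (rule packing_measure_null_UN)
    show "packing_measure \<phi> s \<epsilon> (?A i) = 0" for i
      using range empty assms(2) by (metis insert_iff rangeI)
    show "Z \<subseteq> (\<Union>i. ?A i)"
      using assms(3) range by auto
  qed
qed

text \<open>All times are at least \<open>N\<close>, so raising the exponent from \<open>s\<close>
  to \<open>t\<close> costs every term at least this factor.\<close>

lemma packing_pre_exponential:
  assumes "s \<le> t" "0 \<le> \<epsilon>"
  shows "packing_pre \<phi> t \<epsilon> N Z \<le> ennreal (exp (- (t - s) * real N)) * packing_pre \<phi> s \<epsilon> N Z"
proof (rule ccontr)
  assume "\<not> ?thesis"
  then have "ennreal (exp (- (t - s) * real N)) * packing_pre \<phi> s \<epsilon> N Z < packing_pre \<phi> t \<epsilon> N Z"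
    by simp
  then obtain E \<tau> where E: "finite E" "E \<subseteq> Z" "\<forall>x\<in>E. 0 < \<tau> x \<and> real N \<le> \<tau> x"
    "disjoint_family_on (\<lambda>x. rcball \<phi> x (\<tau> x) \<epsilon>) E"
    and less: "ennreal (exp (- (t - s) * real N)) * packing_pre \<phi> s \<epsilon> N Z
      < (\<Sum>x\<in>E. ennreal (exp (- t * \<tau> x)))"
    by (rule less_packing_preE[OF _ assms(2)])
  have "exp (- t * \<tau> x) \<le> exp (- (t - s) * real N) * exp (- s * \<tau> x)" if "x \<in> E" for x
  proof -
    have "(t - s) * real N \<le> (t - s) * \<tau> x"
      using E(3) that assms(1) by (intro mult_left_mono) auto
    then show ?thesis
      by (simp add: algebra_simps flip: exp_add)
  qed
  then have "(\<Sum>x\<in>E. ennreal (exp (- t * \<tau> x)))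
      \<le> (\<Sum>x\<in>E. ennreal (exp (- (t - s) * real N)) * ennreal (exp (- s * \<tau> x)))"
    by (intro sum_mono) (simp add: ennreal_leI flip: ennreal_mult)
  also have "\<dots> = ennreal (exp (- (t - s) * real N)) * (\<Sum>x\<in>E. ennreal (exp (- s * \<tau> x)))"
    by (simp only: sum_distrib_left)
  also have "\<dots> \<le> ennreal (exp (- (t - s) * real N)) * packing_pre \<phi> s \<epsilon> N Z"
    using E by (intro mult_left_mono sum_le_packing_pre) auto
  finally show False
    using less by simp
qed

text \<open>If the value were finite for one \<open>N\<close>, the values at exponent
  \<open>t\<close> would decay exponentially as \<open>N\<close> grows, and the packing measure
  would vanish.\<close>

lemma packing_pre_eq_top:
  assumes "packing_measure \<phi> t \<epsilon> Z \<noteq> 0" "s < t" "0 \<le> \<epsilon>"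
  shows "packing_pre \<phi> s \<epsilon> N Z = \<infinity>"
proof (rule ccontr)
  assume "packing_pre \<phi> s \<epsilon> N Z \<noteq> \<infinity>"
  then obtain c where c: "packing_pre \<phi> s \<epsilon> N Z = ennreal c" "0 \<le> c"
    by (cases "packing_pre \<phi> s \<epsilon> N Z") auto
  have "packing_measure \<phi> t \<epsilon> Z \<le> ennreal (exp (- (t - s) * real M) * c)" if "M \<ge> N" for M
  proof -
    have "packing_measure \<phi> t \<epsilon> Z \<le> packing_pre \<phi> t \<epsilon> M Z"
      using packing_measure_le_packing_lim[of \<phi> t \<epsilon> Z] unfolding packing_lim_eq_INF
      by (rule order_trans) (rule INF_lower, simp)
    also have "\<dots> \<le> ennreal (exp (- (t - s) * real M)) * packing_pre \<phi> s \<epsilon> M Z"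
      using assms by (intro packing_pre_exponential) auto
    also have "\<dots> \<le> ennreal (exp (- (t - s) * real M)) * packing_pre \<phi> s \<epsilon> N Z"
      using that by (intro mult_left_mono packing_pre_mono) auto
    also have "\<dots> = ennreal (exp (- (t - s) * real M) * c)"
      using c by (simp add: ennreal_mult)
    finally show ?thesis .
  qed
  moreover have "(\<lambda>M. ennreal (exp (- (t - s) * real M) * c)) \<longlonglongrightarrow> ennreal 0"
  proof (rule tendsto_ennrealI)
    have "(\<lambda>M. exp (- (t - s)) ^ M * c) \<longlonglongrightarrow> 0 * c"
      using assms(2) by (intro tendsto_mult tendsto_const LIMSEQ_power_zero) simp
    then show "(\<lambda>M. exp (- (t - s) * real M) * c) \<longlonglongrightarrow> 0"
      by (simp add: mult.commute flip: exp_of_nat_mult)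
  qed
  ultimately have "packing_measure \<phi> t \<epsilon> Z \<le> ennreal 0"
    by (intro LIMSEQ_le_const) auto
  then show False
    using assms(1) by simp
qed

context compact_flow
begin

text \<open>The points removed from \<open>K\<close> lie in countably many null pieces, so removing
  them turns no nonnull set \<open>K \<inter> G\<close> into a null one. This is what makes
  neighborhoods nonnull relative to \<open>K'\<close> itself.\<close>

lemma packing_kernel:
  assumes "packing_measure \<phi> t \<epsilon> K \<noteq> 0"
  obtains K' where "K' \<subseteq> K" "K' \<noteq> {}"
    "\<forall>x\<in>K'. \<forall>r>0. packing_measure \<phi> t \<epsilon> (K' \<inter> ball x r) \<noteq> 0"
proof -
  define K' where "K' = {x \<in> K. \<forall>r>0. packing_measure \<phi> t \<epsilon> (K \<inter> ball x r) \<noteq> 0}"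
  have "\<forall>n. \<exists>C :: 'a set. finite C \<and> UNIV \<subseteq> (\<Union>c\<in>C. ball c (1 / real (Suc n)))"
    using compact_UNIV unfolding compact_eq_totally_bounded by simp
  from choice[OF this] obtain C :: "nat \<Rightarrow> 'a set" where C: "\<And>n. finite (C n)"
    "\<And>n. UNIV \<subseteq> (\<Union>c\<in>C n. ball c (1 / real (Suc n)))"
    by auto
  define \<B> where "\<B> = (\<Union>n. (\<lambda>c. K \<inter> ball c (1 / real (Suc n))) ` C n)"
  define \<A> where "\<A> = {A \<in> \<B>. packing_measure \<phi> t \<epsilon> A = 0}"
  have "countable \<B>"
    unfolding \<B>_def using C(1) by (intro countable_UN) (auto intro: countable_finite)
  then have "countable \<A>"
    unfolding \<A>_def by (rule countable_subset[rotated]) blast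
  have "K - K' \<subseteq> \<Union>\<A>"
  proof
    fix x assume "x \<in> K - K'"
    then obtain r where "x \<in> K" "r > 0" and null: "packing_measure \<phi> t \<epsilon> (K \<inter> ball x r) = 0"
      by (auto simp: K'_def)
    obtain n where "2 / r < real n"
      using reals_Archimedean2 by blast
    \<comment> \<open>A ball of radius \<open>1 / real (Suc n)\<close> containing \<open>x\<close>
      then lies in \<open>ball x r\<close>.\<close>
    then have n: "2 * (1 / real (Suc n)) \<le> r"
      using \<open>r > 0\<close> by (simp add: field_simps)
    have "x \<in> (\<Union>c\<in>C n. ball c (1 / real (Suc n)))"
      using C(2) by blast
    then obtain c where c: "c \<in> C n" "dist c x < 1 / real (Suc n)"
      by auto
    have "ball c (1 / real (Suc n)) \<subseteq> ball x r"
    proof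
      fix y assume "y \<in> ball c (1 / real (Suc n))"
      then show "y \<in> ball x r"
        using c(2) n dist_triangle[of x y c] by (simp add: dist_commute)
    qed
    then have "packing_measure \<phi> t \<epsilon> (K \<inter> ball c (1 / real (Suc n)))
        \<le> packing_measure \<phi> t \<epsilon> (K \<inter> ball x r)"
      by (intro packing_measure_mono) auto
    then have "K \<inter> ball c (1 / real (Suc n)) \<in> \<A>"
      using c(1) null unfolding \<A>_def \<B>_def by auto
    moreover have "x \<in> K \<inter> ball c (1 / real (Suc n))"
      using \<open>x \<in> K\<close> c(2) by simp
    ultimately show "x \<in> \<Union>\<A>"
      by blast
  qed
  then have not_null: "packing_measure \<phi> t \<epsilon> (K' \<inter> G) \<noteq> 0"
    if "packing_measure \<phi> t \<epsilon> (K \<inter> G) \<noteq> 0" for G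
  proof -
    have sub: "K \<inter> G \<subseteq> \<Union>(insert (K' \<inter> G) \<A>)"
      using \<open>K - K' \<subseteq> \<Union>\<A>\<close> by blast
    show ?thesis
      using packing_measure_null_countable[OF _ _ sub, of \<phi> t \<epsilon>] \<open>countable \<A>\<close> that
      unfolding \<A>_def by blast
  qed
  show thesis
  proof (rule that)
    show "K' \<subseteq> K"
      by (auto simp: K'_def)
    show "K' \<noteq> {}"
    proof
      assume "K' = {}"
      then show False
        using not_null[of UNIV] assms packing_measure_le_packing_lim[of \<phi> t \<epsilon> "{}"] by simp
    qed
    show "\<forall>x\<in>K'. \<forall>r>0. packing_measure \<phi> t \<epsilon> (K' \<inter> ball x r) \<noteq> 0"
      using not_null by (auto simp: K'_def)
  qed
qed

end

section \<open>Finite stages of the tree\<close>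

context fixed_point_free_flow
begin

text \<open>Besides the radius \<open>\<gamma>\<close>, a stage consists of a step function \<open>f\<close>, whose values \<open>x\<close> are
  the nodes of level \<open>i\<close> and carry the mass of their fibres, and of the times \<open>m x\<close> for which the
  nodes are followed. The separation clause says that a ball centered near \<open>x\<close> meets no descendant
  of another node; it is stated with radius \<open>\<epsilon> / 2\<close> because closed reparametrization balls are
  not closed sets, so that their disjointness is not stable under moving the centers.\<close>

definition stage ::
  "real measure \<Rightarrow> real \<Rightarrow> real \<Rightarrow> 'a set \<Rightarrow> nat \<Rightarrow> (real \<Rightarrow> 'a) \<times> ('a \<Rightarrow> real) \<times> real \<Rightarrow> bool" where
  "stage M s \<epsilon> K' i = (\<lambda>(f, m, \<gamma>). \<gamma> > 0 \<and> simple_function M f \<and> f ` space M \<subseteq> K' \<and>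
    (\<forall>x\<in>f ` space M. real i \<le> m x \<and> measure M (f -` {x} \<inter> space M) \<le> exp (- s * m x)) \<and>
    (\<forall>x\<in>f ` space M. \<forall>y\<in>f ` space M. x \<noteq> y \<longrightarrow>
      (\<forall>z\<in>cball x \<gamma>. rball \<phi> z (m x) (\<epsilon> / 2) \<inter> cball y \<gamma> = {})))"

text \<open>With the factors 1/4 the total drift over all later levels stays within
  \<open>\<gamma> / 2\<close>, since
  \<open>\<gamma> / 4 + (\<gamma> / 4) / 2 \<le> \<gamma> / 2\<close>; limits therefore remain in
  the closed \<open>\<gamma>\<close>-ball of every ancestor.\<close>

definition refines ::
  "real measure \<Rightarrow> (real \<Rightarrow> 'a) \<times> ('a \<Rightarrow> real) \<times> real \<Rightarrow>
    (real \<Rightarrow> 'a) \<times> ('a \<Rightarrow> real) \<times> real \<Rightarrow> bool" where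
  "refines M = (\<lambda>(f, m, \<gamma>) (f', m', \<gamma>'). \<gamma>' \<le> \<gamma> / 4 \<and>
    (\<forall>u\<in>space M. dist (f u) (f' u) \<le> \<gamma> / 4))"

context
  fixes M :: "real measure" and s \<epsilon> :: real and K' :: "'a set"
  assumes prob: "prob_space M"
    and divisible: "\<And>A v. A \<in> sets M \<Longrightarrow> 0 \<le> v \<Longrightarrow> v \<le> measure M A \<Longrightarrow>
      \<exists>B\<in>sets M. B \<subseteq> A \<and> measure M B = v"
    and \<epsilon>: "\<epsilon> > 0"
    and absorb: "\<And>t. \<exists>d>0. \<forall>x z. dist x z < d \<longrightarrow> rball \<phi> z t (\<epsilon> / 2) \<subseteq> rcball \<phi> x t \<epsilon>"
    and rich: "\<And>x r N. x \<in> K' \<Longrightarrow> r > 0 \<Longrightarrow> packing_pre \<phi> s \<epsilon> N (K' \<inter> ball x r) = \<infinity>"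
begin

text \<open>Packings near \<open>x\<close> have arbitrarily large weight, so one has total capacity
  above \<open>exp (- s * a)\<close>, enough for the mass of \<open>A\<close>. Following a child at
  least as long as its parent lets it inherit the separation of the parent.\<close>

lemma children:
  assumes "x \<in> K'" "\<gamma> > 0" "A \<in> sets M" "measure M A \<le> exp (- s * a)"
  obtains E t g where "finite E" "E \<subseteq> K' \<inter> ball x \<gamma>"
    "\<forall>y\<in>E. real N \<le> t y \<and> a \<le> t y"
    "disjoint_family_on (\<lambda>y. rcball \<phi> y (t y) \<epsilon>) E"
    "\<forall>u. g u \<in> E"
    "\<forall>y\<in>E. A \<inter> g -` {y} \<in> sets M \<and> measure M (A \<inter> g -` {y}) \<le> exp (- s * t y)"
proof -
  interpret prob_space M by (rule prob)
  let ?N = "max N (nat \<lceil>a\<rceil>)"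
  have "ennreal (exp (- s * a)) < packing_pre \<phi> s \<epsilon> ?N (K' \<inter> ball x \<gamma>)"
    by (simp add: rich[OF assms(1,2)])
  then obtain E t where E: "finite E" "E \<subseteq> K' \<inter> ball x \<gamma>" "\<forall>y\<in>E. 0 < t y \<and> real ?N \<le> t y"
    "disjoint_family_on (\<lambda>y. rcball \<phi> y (t y) \<epsilon>) E"
    "ennreal (exp (- s * a)) < (\<Sum>y\<in>E. ennreal (exp (- s * t y)))"
    by (rule less_packing_preE[OF _ less_imp_le[OF \<epsilon>]])
  have "ennreal (exp (- s * a)) < ennreal (\<Sum>y\<in>E. exp (- s * t y))"
    using E(5) by simp
  then have "exp (- s * a) < (\<Sum>y\<in>E. exp (- s * t y))"
    by (subst (asm) ennreal_less_iff) auto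
  moreover from this have "E \<noteq> {}"
    by auto
  ultimately have "\<exists>g. (\<forall>u. g u \<in> E) \<and>
      (\<forall>y\<in>E. A \<inter> g -` {y} \<in> sets M \<and> measure M (A \<inter> g -` {y}) \<le> exp (- s * t y))"
    using E(1) assms(3,4) by (intro distribute_measure divisible) auto
  then obtain g where "\<forall>u. g u \<in> E"
    "\<forall>y\<in>E. A \<inter> g -` {y} \<in> sets M \<and> measure M (A \<inter> g -` {y}) \<le> exp (- s * t y)"
    by (elim exE conjE)
  moreover have "\<forall>y\<in>E. real N \<le> t y \<and> a \<le> t y"
  proof
    fix y assume "y \<in> E"
    then have "real ?N \<le> t y"
      using E(3) by blast
    moreover have "real N \<le> real ?N" "a \<le> real ?N"
      using real_nat_ceiling_ge[of a] by linarith+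
    ultimately show "real N \<le> t y \<and> a \<le> t y"
      by linarith
  qed
  ultimately show thesis
    using E(1,2,4) that by blast
qed

lemma uniform_radius:
  assumes "finite Y"
  obtains \<delta> where "\<delta> > 0"
    "\<forall>y\<in>Y. cball y \<delta> \<subseteq> rcball \<phi> y (t y) \<epsilon> \<and>
      (\<forall>z\<in>cball y \<delta>. rball \<phi> z (t y) (\<epsilon> / 2) \<subseteq> rcball \<phi> y (t y) \<epsilon>)"
proof -
  have "\<forall>y. \<exists>d>0. \<forall>z. dist y z < d \<longrightarrow>
      z \<in> rcball \<phi> y (t y) \<epsilon> \<and> rball \<phi> z (t y) (\<epsilon> / 2) \<subseteq> rcball \<phi> y (t y) \<epsilon>"
  proof
    fix y
    obtain d1 where d1: "d1 > 0" "\<forall>x z. dist x z < d1 \<longrightarrow> z \<in> rcball \<phi> x (t y) \<epsilon>"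
      using dist_less_in_rcball[OF \<epsilon>, of "t y"] by metis
    obtain d2 where d2: "d2 > 0"
      "\<forall>x z. dist x z < d2 \<longrightarrow> rball \<phi> z (t y) (\<epsilon> / 2) \<subseteq> rcball \<phi> x (t y) \<epsilon>"
      using absorb by blast
    show "\<exists>d>0. \<forall>z. dist y z < d \<longrightarrow>
        z \<in> rcball \<phi> y (t y) \<epsilon> \<and> rball \<phi> z (t y) (\<epsilon> / 2) \<subseteq> rcball \<phi> y (t y) \<epsilon>"
      using d1 d2 by (intro exI[of _ "min d1 d2"]) auto
  qed
  from choice[OF this] obtain d where d: "\<And>y. d y > 0"
    "\<And>y z. dist y z < d y \<Longrightarrow> z \<in> rcball \<phi> y (t y) \<epsilon>"
    "\<And>y z. dist y z < d y \<Longrightarrow> rball \<phi> z (t y) (\<epsilon> / 2) \<subseteq> rcball \<phi> y (t y) \<epsilon>"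
    by auto
  \<comment> \<open>Half the minimum is strictly below each \<open>d y\<close>, as closed balls
    require; the inserted 1 covers an empty \<open>Y\<close>.\<close>
  define \<delta> where "\<delta> = Min (insert 1 (d ` Y)) / 2"
  have "0 < Min (insert 1 (d ` Y))"
    using assms d(1) by (subst Min_gr_iff) auto
  then have "\<delta> > 0"
    by (simp add: \<delta>_def)
  have "\<delta> < d y" if "y \<in> Y" for y
  proof -
    have "Min (insert 1 (d ` Y)) \<le> d y"
      using assms that by (intro Min_le) auto
    then show ?thesis
      using \<open>0 < Min (insert 1 (d ` Y))\<close> by (simp add: \<delta>_def)
  qed
  then have "z \<in> rcball \<phi> y (t y) \<epsilon> \<and> rball \<phi> z (t y) (\<epsilon> / 2) \<subseteq> rcball \<phi> y (t y) \<epsilon>"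
    if "y \<in> Y" "z \<in> cball y \<delta>" for y z
  proof -
    have "dist y z < d y"
      using \<open>y \<in> Y\<close> \<open>z \<in> cball y \<delta>\<close> \<open>\<And>y. y \<in> Y \<Longrightarrow> \<delta> < d y\<close> by (auto intro: le_less_trans)
    then show ?thesis
      using d(2,3) by simp
  qed
  then show thesis
    using that \<open>\<delta> > 0\<close> by blast
qed

text \<open>New nodes are separated for two reasons: children of one parent because their packing
  balls are disjoint, transferred to nearby centers by \<open>uniform_radius\<close>; children of
  different parents because they stay near the parents and longer times only shrink the
  balls.\<close>

lemma refine:
  assumes "stage M s \<epsilon> K' i p"
  shows "\<exists>p'. stage M s \<epsilon> K' (Suc i) p' \<and> refines M p p'"
proof -
  interpret prob_space M by (rule prob)
  obtain f m \<gamma> where p: "p = (f, m, \<gamma>)"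
    using prod_cases3 by blast
  define X where "X = f ` space M"
  have st: "\<gamma> > 0 \<and> simple_function M f \<and> X \<subseteq> K' \<and>
      (\<forall>x\<in>X. real i \<le> m x \<and> measure M (f -` {x} \<inter> space M) \<le> exp (- s * m x)) \<and>
      (\<forall>x\<in>X. \<forall>y\<in>X. x \<noteq> y \<longrightarrow> (\<forall>z\<in>cball x \<gamma>. rball \<phi> z (m x) (\<epsilon> / 2) \<inter> cball y \<gamma> = {}))"
    using assms unfolding stage_def p X_def prod.case .
  then have \<gamma>: "\<gamma> > 0" and simple: "simple_function M f" and X: "X \<subseteq> K'"
    and mass: "\<And>x. x \<in> X \<Longrightarrow> measure M (f -` {x} \<inter> space M) \<le> exp (- s * m x)"
    by simp_all
  have sep: "rball \<phi> z (m x) (\<epsilon> / 2) \<inter> cball y \<gamma> = {}"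
    if "x \<in> X" "y \<in> X" "x \<noteq> y" "z \<in> cball x \<gamma>" for x y z
    using st that by metis
  have "finite X" and fibre: "\<And>x. x \<in> X \<Longrightarrow> f -` {x} \<inter> space M \<in> sets M"
    using simple by (auto simp: simple_function_def X_def)
  have "\<forall>x\<in>X. \<exists>E t g. finite E \<and> E \<subseteq> K' \<inter> ball x (\<gamma> / 4) \<and>
      (\<forall>y\<in>E. real (Suc i) \<le> t y \<and> m x \<le> t y) \<and>
      disjoint_family_on (\<lambda>y. rcball \<phi> y (t y) \<epsilon>) E \<and> (\<forall>u. g u \<in> E) \<and>
      (\<forall>y\<in>E. (f -` {x} \<inter> space M) \<inter> g -` {y} \<in> sets M \<and>
        measure M ((f -` {x} \<inter> space M) \<inter> g -` {y}) \<le> exp (- s * t y))"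
  proof
    fix x assume "x \<in> X"
    then have "x \<in> K'" "\<gamma> / 4 > 0"
      using X \<gamma> by auto
    from children[OF this fibre[OF \<open>x \<in> X\<close>] mass[OF \<open>x \<in> X\<close>], of "Suc i"]
    obtain E t g where "finite E" "E \<subseteq> K' \<inter> ball x (\<gamma> / 4)"
      "\<forall>y\<in>E. real (Suc i) \<le> t y \<and> m x \<le> t y"
      "disjoint_family_on (\<lambda>y. rcball \<phi> y (t y) \<epsilon>) E" "\<forall>u. g u \<in> E"
      "\<forall>y\<in>E. (f -` {x} \<inter> space M) \<inter> g -` {y} \<in> sets M \<and>
        measure M ((f -` {x} \<inter> space M) \<inter> g -` {y}) \<le> exp (- s * t y)" .
    then show "\<exists>E t g. finite E \<and> E \<subseteq> K' \<inter> ball x (\<gamma> / 4) \<and>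
      (\<forall>y\<in>E. real (Suc i) \<le> t y \<and> m x \<le> t y) \<and>
      disjoint_family_on (\<lambda>y. rcball \<phi> y (t y) \<epsilon>) E \<and> (\<forall>u. g u \<in> E) \<and>
      (\<forall>y\<in>E. (f -` {x} \<inter> space M) \<inter> g -` {y} \<in> sets M \<and>
        measure M ((f -` {x} \<inter> space M) \<inter> g -` {y}) \<le> exp (- s * t y))"
      by (intro exI conjI)
  qed
  from bchoice[OF this] obtain E where "\<forall>x\<in>X. \<exists>t g. finite (E x) \<and> E x \<subseteq> K' \<inter> ball x (\<gamma> / 4) \<and>
      (\<forall>y\<in>E x. real (Suc i) \<le> t y \<and> m x \<le> t y) \<and>
      disjoint_family_on (\<lambda>y. rcball \<phi> y (t y) \<epsilon>) (E x) \<and> (\<forall>u. g u \<in> E x) \<and>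
      (\<forall>y\<in>E x. (f -` {x} \<inter> space M) \<inter> g -` {y} \<in> sets M \<and>
        measure M ((f -` {x} \<inter> space M) \<inter> g -` {y}) \<le> exp (- s * t y))" ..
  from bchoice[OF this] obtain t where "\<forall>x\<in>X. \<exists>g. finite (E x) \<and> E x \<subseteq> K' \<inter> ball x (\<gamma> / 4) \<and>
      (\<forall>y\<in>E x. real (Suc i) \<le> t x y \<and> m x \<le> t x y) \<and>
      disjoint_family_on (\<lambda>y. rcball \<phi> y (t x y) \<epsilon>) (E x) \<and> (\<forall>u. g u \<in> E x) \<and>
      (\<forall>y\<in>E x. (f -` {x} \<inter> space M) \<inter> g -` {y} \<in> sets M \<and>
        measure M ((f -` {x} \<inter> space M) \<inter> g -` {y}) \<le> exp (- s * t x y))" ..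
  from bchoice[OF this] obtain g where all: "\<forall>x\<in>X. finite (E x) \<and> E x \<subseteq> K' \<inter> ball x (\<gamma> / 4) \<and>
      (\<forall>y\<in>E x. real (Suc i) \<le> t x y \<and> m x \<le> t x y) \<and>
      disjoint_family_on (\<lambda>y. rcball \<phi> y (t x y) \<epsilon>) (E x) \<and> (\<forall>u. g x u \<in> E x) \<and>
      (\<forall>y\<in>E x. (f -` {x} \<inter> space M) \<inter> g x -` {y} \<in> sets M \<and>
        measure M ((f -` {x} \<inter> space M) \<inter> g x -` {y}) \<le> exp (- s * t x y))" ..
  have E: "finite (E x)" "E x \<subseteq> K'" "E x \<subseteq> ball x (\<gamma> / 4)" if "x \<in> X" for x
    using all that by auto
  have t: "real (Suc i) \<le> t x y" "m x \<le> t x y" if "x \<in> X" "y \<in> E x" for x y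
    using all that by auto
  have disj: "rcball \<phi> y (t x y) \<epsilon> \<inter> rcball \<phi> z (t x z) \<epsilon> = {}"
    if "x \<in> X" "y \<in> E x" "z \<in> E x" "y \<noteq> z" for x y z
    using all that disjoint_family_onD[of "\<lambda>y. rcball \<phi> y (t x y) \<epsilon>" "E x" y z] by blast
  have g: "g x u \<in> E x" if "x \<in> X" for x u
    using all that by blast
  have g_fibre: "(f -` {x} \<inter> space M) \<inter> g x -` {y} \<in> sets M"
    and g_mass: "measure M ((f -` {x} \<inter> space M) \<inter> g x -` {y}) \<le> exp (- s * t x y)"
    if "x \<in> X" "y \<in> E x" for x y
    using all that by auto
  have near: "y \<in> cball x \<gamma>" if "x \<in> X" "y \<in> E x" for x y
    using E(3)[OF that(1)] that(2) \<gamma> by auto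
  \<comment> \<open>A common child would be the center of a ball near \<open>x\<close> and also lie
    near \<open>x'\<close>, against the separation of the parents.\<close>
  have unique: "x = x'" if "x \<in> X" "x' \<in> X" "y \<in> E x" "y \<in> E x'" for x x' y
  proof (rule ccontr)
    assume "x \<noteq> x'"
    then have "rball \<phi> y (m x) (\<epsilon> / 2) \<inter> cball x' \<gamma> = {}"
      using that near by (intro sep) auto
    then show False
      using near[OF that(2,4)] center_in_rball[of "\<epsilon> / 2" y \<phi> "m x"] \<epsilon> by auto
  qed
  \<comment> \<open>The time \<open>m'\<close> has to depend on the node alone, so the parent must
    be recovered from the child.\<close>
  define parent where "parent y = (THE x. x \<in> X \<and> y \<in> E x)" for y
  have parent: "parent y = x" if "x \<in> X" "y \<in> E x" for x y
    unfolding parent_def using that unique by (intro the_equality) auto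
  define f' where "f' u = g (f u) u" for u
  define m' where "m' y = t (parent y) y" for y
  define Y where "Y = (\<Union>x\<in>X. E x)"
  have "finite Y"
    using \<open>finite X\<close> E(1) by (simp add: Y_def)
  then obtain \<delta> where \<delta>: "\<delta> > 0"
    "\<forall>y\<in>Y. cball y \<delta> \<subseteq> rcball \<phi> y (m' y) \<epsilon> \<and>
      (\<forall>z\<in>cball y \<delta>. rball \<phi> z (m' y) (\<epsilon> / 2) \<subseteq> rcball \<phi> y (m' y) \<epsilon>)"
    by (rule uniform_radius)
  \<comment> \<open>The bound \<open>\<delta>\<close> serves siblings; \<open>\<gamma> / 4\<close>
    keeps the ball of a child inside that of its parent.\<close>
  define \<gamma>' where "\<gamma>' = min \<delta> (\<gamma> / 4)"
  have \<gamma>': "\<gamma>' > 0" "\<gamma>' \<le> \<delta>" "\<gamma>' \<le> \<gamma> / 4"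
    using \<delta>(1) \<gamma> by (auto simp: \<gamma>'_def)
  have fX: "f u \<in> X" if "u \<in> space M" for u
    using that by (simp add: X_def)
  have f'_in: "f' u \<in> E (f u)" if "u \<in> space M" for u
    using g fX that by (simp add: f'_def)
  \<comment> \<open>Only an inclusion: points of \<open>Y\<close> that receive no part drop out, and
    a stage constrains just the values of \<open>f'\<close>.\<close>
  have f'_Y: "f' ` space M \<subseteq> Y"
    using f'_in fX by (auto simp: Y_def)
  have f'_fibre: "f' -` {y} \<inter> space M = (f -` {x} \<inter> space M) \<inter> g x -` {y}"
    if "x \<in> X" "y \<in> E x" for x y
  proof -
    have "f u = x" if "u \<in> space M" "f' u = y" for u
      using unique[OF fX[OF that(1)] \<open>x \<in> X\<close>] f'_in[OF that(1)] that(2) \<open>y \<in> E x\<close> by simp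
    then show ?thesis
      by (auto simp: f'_def)
  qed
  have m': "m' y = t x y" if "x \<in> X" "y \<in> E x" for x y
    using parent[OF that] by (simp add: m'_def)
  have shrink: "cball y \<gamma>' \<subseteq> cball x \<gamma>" if "x \<in> X" "y \<in> E x" for x y
  proof
    fix z assume "z \<in> cball y \<gamma>'"
    moreover have "dist x y < \<gamma> / 4"
      using E(3)[OF that(1)] that(2) by auto
    ultimately show "z \<in> cball x \<gamma>"
      using \<gamma>'(3) \<gamma> dist_triangle[of x z y] by auto
  qed
  have "rball \<phi> z (m' y) (\<epsilon> / 2) \<inter> cball y' \<gamma>' = {}"
    if y: "y \<in> Y" "y' \<in> Y" "y \<noteq> y'" "z \<in> cball y \<gamma>'" for y y' z
  proof -
    obtain x x' where x: "x \<in> X" "y \<in> E x" and x': "x' \<in> X" "y' \<in> E x'"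
      using y(1,2) by (auto simp: Y_def)
    show ?thesis
    proof (cases "x = x'")
      case True
      have "rball \<phi> z (m' y) (\<epsilon> / 2) \<subseteq> rcball \<phi> y (m' y) \<epsilon>"
        using \<delta>(2) y(1,4) \<gamma>'(2) by auto
      moreover have "cball y' \<gamma>' \<subseteq> rcball \<phi> y' (m' y') \<epsilon>"
        using \<delta>(2) y(2) \<gamma>'(2) subset_cball[of \<gamma>' \<delta> y'] by blast
      moreover have "rcball \<phi> y (m' y) \<epsilon> \<inter> rcball \<phi> y' (m' y') \<epsilon> = {}"
        using disj[of x y y'] x x' True y(3) m'[OF x] m'[OF x'] by simp
      ultimately show ?thesis
        by blast
    next
      case False
      have "rball \<phi> z (m x) (\<epsilon> / 2) \<inter> cball x' \<gamma> = {}"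
        using shrink[OF x] y(4) x(1) x'(1) False by (intro sep) auto
      moreover have "rball \<phi> z (m' y) (\<epsilon> / 2) \<subseteq> rball \<phi> z (m x) (\<epsilon> / 2)"
        using t(2)[OF x] m'[OF x] by (intro rball_antimono_time) simp
      ultimately show ?thesis
        using shrink[OF x'] by blast
    qed
  qed
  moreover have "real (Suc i) \<le> m' y \<and> f' -` {y} \<inter> space M \<in> sets M \<and>
      measure M (f' -` {y} \<inter> space M) \<le> exp (- s * m' y)" if "y \<in> Y" for y
  proof -
    obtain x where x: "x \<in> X" "y \<in> E x"
      using \<open>y \<in> Y\<close> by (auto simp: Y_def)
    show ?thesis
      using t(1)[OF x] g_fibre[OF x] g_mass[OF x] unfolding m'[OF x] f'_fibre[OF x] by simp
  qed
  moreover have "Y \<subseteq> K'"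
    using E(2) by (auto simp: Y_def)
  ultimately have "stage M s \<epsilon> K' (Suc i) (f', m', \<gamma>')"
    using f'_Y \<gamma>'(1) \<open>finite Y\<close> finite_subset
    unfolding stage_def simple_function_def prod.case by (intro conjI ballI impI) blast+
  moreover have "refines M p (f', m', \<gamma>')"
    unfolding refines_def p prod.case
  proof (intro conjI ballI)
    fix u assume "u \<in> space M"
    then show "dist (f u) (f' u) \<le> \<gamma> / 4"
      using E(3)[OF fX] f'_in by (meson less_imp_le mem_ball subsetD)
  qed fact
  ultimately show ?thesis
    by blast
qed

text \<open>The root is the single node \<open>x0\<close> with time 0, whose cap
  \<open>exp 0 = 1\<close> is the whole mass.\<close>

lemma stages:
  assumes "x0 \<in> K'"
  obtains p where "\<forall>n. stage M s \<epsilon> K' n (p n) \<and> refines M (p n) (p (Suc n))"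
proof -
  interpret prob_space M by (rule prob)
  have "\<exists>p. stage M s \<epsilon> K' 0 p"
  proof
    show "stage M s \<epsilon> K' 0 (\<lambda>_. x0, \<lambda>_. 0, 1)"
      using assms by (auto simp: stage_def image_constant_conv)
  qed
  from dependent_nat_choice[of "stage M s \<epsilon> K'" "\<lambda>_. refines M", OF this refine] that show thesis
    by blast
qed

end

end

section \<open>The limit measure\<close>

context fixed_point_free_flow
begin

context
  fixes M :: "real measure" and s \<epsilon> :: real and K' K :: "'a set"
    and f :: "nat \<Rightarrow> real \<Rightarrow> 'a" and m :: "nat \<Rightarrow> 'a \<Rightarrow> real" and \<gamma> :: "nat \<Rightarrow> real"
  assumes prob: "prob_space M" and s: "0 \<le> s" and \<epsilon>: "\<epsilon> > 0"
    and K: "closed K" "K' \<subseteq> K"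
    and stage: "\<And>n. stage M s \<epsilon> K' n (f n, m n, \<gamma> n)"
    and refines: "\<And>n. refines M (f n, m n, \<gamma> n) (f (Suc n), m (Suc n), \<gamma> (Suc n))"
begin

lemma stageD:
  "\<gamma> n > 0" "simple_function M (f n)" "f n ` space M \<subseteq> K'"
  "x \<in> f n ` space M \<Longrightarrow> real n \<le> m n x"
  "x \<in> f n ` space M \<Longrightarrow> measure M (f n -` {x} \<inter> space M) \<le> exp (- s * m n x)"
  "x \<in> f n ` space M \<Longrightarrow> y \<in> f n ` space M \<Longrightarrow> x \<noteq> y \<Longrightarrow> z \<in> cball x (\<gamma> n) \<Longrightarrow>
    rball \<phi> z (m n x) (\<epsilon> / 2) \<inter> cball y (\<gamma> n) = {}"
proof -
  note st = stage[of n, unfolded stage_def prod.case]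
  show "\<gamma> n > 0" "simple_function M (f n)" "f n ` space M \<subseteq> K'"
    using st by simp_all
  show "x \<in> f n ` space M \<Longrightarrow> real n \<le> m n x"
    "x \<in> f n ` space M \<Longrightarrow> measure M (f n -` {x} \<inter> space M) \<le> exp (- s * m n x)"
    using st by blast+
  show "x \<in> f n ` space M \<Longrightarrow> y \<in> f n ` space M \<Longrightarrow> x \<noteq> y \<Longrightarrow> z \<in> cball x (\<gamma> n) \<Longrightarrow>
    rball \<phi> z (m n x) (\<epsilon> / 2) \<inter> cball y (\<gamma> n) = {}"
    using st by metis
qed

lemma refinesD:
  "\<gamma> (Suc n) \<le> \<gamma> n / 4" "u \<in> space M \<Longrightarrow> dist (f n u) (f (Suc n) u) \<le> \<gamma> n / 4"
  using refines[of n] by (auto simp: refines_def)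

lemma dist_later_stage:
  assumes "u \<in> space M"
  shows "dist (f n u) (f (n + k) u) \<le> \<gamma> n / 2"
proof (induction k arbitrary: n)
  case 0
  then show ?case
    using stageD(1)[of n] by simp
next
  case (Suc k)
  have "dist (f n u) (f (n + Suc k) u) \<le> dist (f n u) (f (Suc n) u) + dist (f (Suc n) u) (f (Suc n + k) u)"
    by (simp add: dist_triangle)
  also have "\<dots> \<le> \<gamma> n / 4 + \<gamma> (Suc n) / 2"
    using refinesD(2)[OF assms] Suc.IH by (intro add_mono)
  also have "\<dots> \<le> \<gamma> n / 2"
    using refinesD(1)[of n] stageD(1)[of n] by simp
  finally show ?case .
qed

lemma radius_tendsto_0: "\<gamma> \<longlonglongrightarrow> 0"
proof (rule tendsto_sandwich[OF _ _ tendsto_const])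
  have "\<gamma> n \<le> (1 / 4) ^ n * \<gamma> 0" for n
  proof (induction n)
    case (Suc n)
    then show ?case
      using refinesD(1)[of n] by simp
  qed simp
  then show "\<forall>\<^sub>F n in sequentially. \<gamma> n \<le> (1 / 4) ^ n * \<gamma> 0"
    by simp
  show "\<forall>\<^sub>F n in sequentially. 0 \<le> \<gamma> n"
    using stageD(1) by (simp add: less_imp_le)
  show "(\<lambda>n. (1 / 4) ^ n * \<gamma> 0) \<longlonglongrightarrow> 0"
    by (intro tendsto_mult_left_zero LIMSEQ_power_zero) simp
qed

text \<open>The step functions are uniformly Cauchy, and a compact space is complete. The nodes lie
  in \<open>K'\<close>; their limits are placed in \<open>K\<close> because \<open>K\<close> is
  closed.\<close>

lemma limit_map:
  obtains F where "F \<in> borel_measurable M" "\<forall>n. \<forall>u\<in>space M. dist (f n u) (F u) \<le> \<gamma> n"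
    "\<forall>u\<in>space M. F u \<in> K"
proof -
  define F where "F u = lim (\<lambda>n. f n u)" for u
  have lim: "(\<lambda>n. f n u) \<longlonglongrightarrow> F u" if u: "u \<in> space M" for u
  proof -
    have "Cauchy (\<lambda>n. f n u)"
    proof (rule metric_CauchyI)
      fix e :: real assume "e > 0"
      then obtain N where N: "\<gamma> N < e"
        using order_tendstoD(2)[OF radius_tendsto_0] unfolding eventually_sequentially by blast
      have "dist (f n u) (f n' u) < e" if "n \<ge> N" "n' \<ge> N" for n n'
        using dist_later_stage[OF u, of N "n - N"] dist_later_stage[OF u, of N "n' - N"] that N
          dist_triangle3[of "f n u" "f n' u" "f N u"] by simp
      then show "\<exists>N. \<forall>n\<ge>N. \<forall>n'\<ge>N. dist (f n u) (f n' u) < e"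
        by blast
    qed
    then obtain l where "(\<lambda>n. f n u) \<longlonglongrightarrow> l"
      using compact_imp_complete[OF compact_UNIV] by (auto simp: complete_def)
    then show ?thesis
      by (simp add: F_def limI)
  qed
  show thesis
  proof (rule that)
    show "F \<in> borel_measurable M"
      using borel_measurable_simple_function[OF stageD(2)] lim by (rule borel_measurable_LIMSEQ_metric)
    show "\<forall>n. \<forall>u\<in>space M. dist (f n u) (F u) \<le> \<gamma> n"
    proof (intro allI ballI)
      fix n u assume u: "u \<in> space M"
      have "(\<lambda>k. dist (f n u) (f (k + n) u)) \<longlonglongrightarrow> dist (f n u) (F u)"
        using LIMSEQ_ignore_initial_segment[OF lim[OF u], of n] by (intro tendsto_dist tendsto_const)
      then show "dist (f n u) (F u) \<le> \<gamma> n"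
      proof (rule LIMSEQ_le_const2, intro exI allI impI)
        fix k
        show "dist (f n u) (f (k + n) u) \<le> \<gamma> n"
          using dist_later_stage[OF u, of n k] stageD(1)[of n] by (simp add: add.commute)
      qed
    qed
    show "\<forall>u\<in>space M. F u \<in> K"
    proof
      fix u assume u: "u \<in> space M"
      then have "f n u \<in> K" for n
        using stageD(3)[of n] K(2) by blast
      then show "F u \<in> K"
        using closed_sequentially[OF K(1) _ lim[OF u]] by blast
    qed
  qed
qed

text \<open>A point of \<open>S\<close> lies near some node \<open>x\<close> of each level
  \<open>n\<close>. By separation its ball of time \<open>m n x\<close> contains limits of
  descendants of \<open>x\<close> only, so its mass is at most \<open>exp (- s * m n x)\<close>. As
  \<open>m n x \<ge> n\<close>, this happens at arbitrarily large times.\<close>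

lemma entropy_of_limit:
  obtains \<mu> where "\<mu> \<in> borel_prob_measures" "measure \<mu> K = 1" "ennreal s \<le> upper_local_entropy \<phi> \<mu>"
proof -
  interpret M: prob_space M by (rule prob)
  obtain F where F[measurable]: "F \<in> borel_measurable M"
    and near: "\<forall>n. \<forall>u\<in>space M. dist (f n u) (F u) \<le> \<gamma> n" and FK: "\<forall>u\<in>space M. F u \<in> K"
    by (rule limit_map)
  define \<mu> where "\<mu> = distr M borel F"
  have \<mu>: "\<mu> \<in> borel_prob_measures"
    unfolding borel_prob_measures_def \<mu>_def using M.prob_space_distr[OF F] by simp
  have full: "measure \<mu> S = 1" if "S \<in> sets borel" "\<forall>u\<in>space M. F u \<in> S" for S
  proof -
    have "F -` S \<inter> space M = space M"
      using that(2) by auto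
    then show ?thesis
      using that(1) M.prob_space unfolding \<mu>_def by (simp add: measure_distr[OF F])
  qed
  \<comment> \<open>A closed, hence Borel, set containing all values of \<open>F\<close>; near-node
    points are all that the estimate uses.\<close>
  define S where "S = (\<Inter>n. \<Union>x\<in>f n ` space M. cball x (\<gamma> n))"
  have "closed S"
    unfolding S_def using stageD(2)
    by (intro closed_INT ballI closed_UN) (auto simp: simple_function_def)
  then have S: "S \<in> sets borel"
    by simp
  have FS: "\<forall>u\<in>space M. F u \<in> S"
    using near by (auto simp: S_def)
  have "ennreal s \<le> upper_local_entropy_at \<phi> \<mu> z" if "z \<in> S" for z
  proof -
    have small: "\<exists>t\<ge>real n. measure \<mu> (rball \<phi> z t (\<epsilon> / 2)) \<le> exp (- s * t)" for n
    proof -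
      obtain x where x: "x \<in> f n ` space M" "z \<in> cball x (\<gamma> n)"
        using \<open>z \<in> S\<close> unfolding S_def by blast
      \<comment> \<open>If \<open>f n u\<close> were another node, \<open>F u\<close> would lie in
        its closed \<open>\<gamma> n\<close>-ball, which the ball around \<open>z\<close>
        misses.\<close>
      have "F -` rball \<phi> z (m n x) (\<epsilon> / 2) \<inter> space M \<subseteq> f n -` {x} \<inter> space M"
      proof
        fix u assume "u \<in> F -` rball \<phi> z (m n x) (\<epsilon> / 2) \<inter> space M"
        then have u: "u \<in> space M" "F u \<in> rball \<phi> z (m n x) (\<epsilon> / 2)"
          by auto
        have "F u \<in> cball (f n u) (\<gamma> n)"
          using near u(1) by simp
        then have "f n u = x"
          using stageD(6)[OF x(1) imageI[OF u(1)] _ x(2)] u(2) by blast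
        then show "u \<in> f n -` {x} \<inter> space M"
          using u(1) by simp
      qed
      moreover have "f n -` {x} \<inter> space M \<in> sets M"
        using stageD(2)[of n] x(1) by (auto simp: simple_function_def)
      ultimately have "measure M (F -` rball \<phi> z (m n x) (\<epsilon> / 2) \<inter> space M) \<le> exp (- s * m n x)"
        using M.finite_measure_mono stageD(5)[OF x(1)] order_trans by blast
      then have "measure \<mu> (rball \<phi> z (m n x) (\<epsilon> / 2)) \<le> exp (- s * m n x)"
        unfolding \<mu>_def using open_rball by (subst measure_distr[OF F]) auto
      then show ?thesis
        using stageD(4)[OF x(1)] by blast
    qed
    have "ennreal s \<le> Limsup at_top (\<lambda>t. neg_log (measure \<mu> (rball \<phi> z t (\<epsilon> / 2))) / ennreal t)"
    proof (rule ccontr)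
      assume "\<not> ?thesis"
      then have "\<forall>\<^sub>F t in at_top. neg_log (measure \<mu> (rball \<phi> z t (\<epsilon> / 2))) / ennreal t < ennreal s"
        by (intro Limsup_lessD) simp
      then obtain T where T: "\<And>t. t \<ge> T \<Longrightarrow>
          neg_log (measure \<mu> (rball \<phi> z t (\<epsilon> / 2))) / ennreal t < ennreal s"
        unfolding eventually_at_top_linorder by blast
      obtain n where n: "max T 1 \<le> real n"
        using real_arch_simple by blast
      then obtain t where t: "t \<ge> real n" "measure \<mu> (rball \<phi> z t (\<epsilon> / 2)) \<le> exp (- s * t)"
        using small by blast
      then have "ennreal s \<le> neg_log (measure \<mu> (rball \<phi> z t (\<epsilon> / 2))) / ennreal t"
        using n s by (intro le_neg_log_divI) auto
      then show False
        using T[of t] t(1) n by (auto simp: not_le[symmetric])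
    qed
    also have "\<dots> \<le> upper_local_entropy_at \<phi> \<mu> z"
      unfolding upper_local_entropy_at_eq_SUP[OF \<mu>] using \<epsilon> by (intro SUP_upper) simp
    finally show ?thesis .
  qed
  then have "(\<integral>\<^sup>+ z. ennreal s * indicator S z \<partial>\<mu>) \<le> upper_local_entropy \<phi> \<mu>"
    unfolding upper_local_entropy_def by (intro nn_integral_mono) (auto simp: indicator_def)
  moreover have "(\<integral>\<^sup>+ z. ennreal s * indicator S z \<partial>\<mu>) = ennreal s * emeasure \<mu> S"
    using S by (intro nn_integral_cmult_indicator) (simp add: \<mu>_def)
  moreover have "emeasure \<mu> S = 1"
  proof -
    interpret \<mu>: prob_space \<mu>
      using \<mu> by (simp add: borel_prob_measures_def)
    show ?thesis
      by (simp add: \<mu>.emeasure_eq_measure full[OF S FS])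
  qed
  ultimately have "ennreal s \<le> upper_local_entropy \<phi> \<mu>"
    by simp
  moreover have "measure \<mu> K = 1"
    using K(1) FK by (intro full) auto
  ultimately show thesis
    using that \<mu> by blast
qed

end

text \<open>The radius must be below \<open>\<epsilon>0\<close>, for moving centers, and small
  enough that the entropy at this radius still exceeds \<open>s\<close>. An exponent
  \<open>t\<close> strictly between is needed: nonnull packing measure at \<open>t\<close> yields
  packings of infinite weight at \<open>s\<close>.\<close>

lemma measure_of_large_entropy:
  assumes "compact K" "0 \<le> s" "ennreal s < packing_entropy \<phi> K"
  obtains \<mu> where "\<mu> \<in> borel_prob_measures" "measure \<mu> K = 1" "ennreal s \<le> upper_local_entropy \<phi> \<mu>"
proof -
  obtain \<epsilon>0 where \<epsilon>0: "\<epsilon>0 > 0"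
    and absorb: "\<And>\<epsilon> t. 0 < \<epsilon> \<Longrightarrow> \<epsilon> \<le> \<epsilon>0 \<Longrightarrow>
      \<exists>d>0. \<forall>x z. dist x z < d \<longrightarrow> rball \<phi> z t (\<epsilon> / 2) \<subseteq> rcball \<phi> x t \<epsilon>"
    by (rule rball_subset_rcball) blast
  obtain e where "e > 0" and e: "ennreal s < packing_entropy_at \<phi> K e"
    using assms(3) unfolding packing_entropy_eq_SUP less_SUP_iff by auto
  define \<epsilon> where "\<epsilon> = min e \<epsilon>0"
  have \<epsilon>: "0 < \<epsilon>" "\<epsilon> \<le> \<epsilon>0" "\<epsilon> \<le> e"
    using \<open>e > 0\<close> \<epsilon>0 by (auto simp: \<epsilon>_def)
  have "ennreal s < packing_entropy_at \<phi> K \<epsilon>"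
    using e packing_entropy_at_antimono[OF \<epsilon>(3)] by (rule less_le_trans)
  then obtain b where b: "ennreal s < b" "b < packing_entropy_at \<phi> K \<epsilon>"
    using dense by blast
  then obtain t where t: "b = ennreal t" "0 \<le> t"
    by (cases b) auto
  have "s < t"
    using b(1) t assms(2) by (simp add: ennreal_less_iff)
  have "packing_measure \<phi> t \<epsilon> K \<noteq> 0"
    using b(2) t by (intro packing_measure_neq_0) auto
  then obtain K' where K': "K' \<subseteq> K" "K' \<noteq> {}"
    and kernel: "\<forall>x\<in>K'. \<forall>r>0. packing_measure \<phi> t \<epsilon> (K' \<inter> ball x r) \<noteq> 0"
    by (rule packing_kernel)
  obtain x0 where "x0 \<in> K'"
    using K'(2) by blast
  define M where "M = restrict_space lborel {0..1::real}"
  have M: "prob_space M"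
    unfolding M_def by (rule prob_space_restrict_space) auto
  have divisible: "\<exists>B\<in>sets M. B \<subseteq> A \<and> measure M B = v"
    if "A \<in> sets M" "0 \<le> v" "v \<le> measure M A" for A v
    using unit_interval_divisible[OF that[unfolded M_def]] unfolding M_def by blast
  have rich: "packing_pre \<phi> s \<epsilon> N (K' \<inter> ball x r) = \<infinity>" if "x \<in> K'" "r > 0" for x r N
    using kernel that \<open>s < t\<close> \<epsilon>(1) by (intro packing_pre_eq_top[of _ t]) auto
  obtain p where p: "\<forall>n. stage M s \<epsilon> K' n (p n) \<and> refines M (p n) (p (Suc n))"
    by (rule stages[OF M divisible \<epsilon>(1) absorb[OF \<epsilon>(1,2)] rich \<open>x0 \<in> K'\<close>])
  define f where "f n = fst (p n)" for n
  define m where "m n = fst (snd (p n))" for n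
  define \<gamma> where "\<gamma> n = snd (snd (p n))" for n
  have p_eq: "p n = (f n, m n, \<gamma> n)" for n
    by (simp add: f_def m_def \<gamma>_def)
  show thesis
  proof (rule entropy_of_limit[OF M assms(2) \<epsilon>(1) compact_imp_closed[OF assms(1)] K'(1)])
    show "stage M s \<epsilon> K' n (f n, m n, \<gamma> n)" for n
      using p p_eq by metis
    show "refines M (f n, m n, \<gamma> n) (f (Suc n), m (Suc n), \<gamma> (Suc n))" for n
      using p p_eq by metis
  qed (rule that)
qed

end

theorem theorem3p2:
  fixes \<phi> :: "real \<Rightarrow> 'a::metric_space \<Rightarrow> 'a" and K :: "'a set"
  assumes "compact (UNIV :: 'a set)"
    and "flow \<phi>"
    and "no_fixed_points \<phi>"
    and "compact K" and "K \<noteq> {}"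
  shows "packing_entropy \<phi> K =
    Sup {upper_local_entropy \<phi> \<mu> | \<mu>. \<mu> \<in> borel_prob_measures \<and> measure \<mu> K = 1}"
proof -
  interpret fixed_point_free_flow \<phi>
    using assms(1-3) by unfold_locales
  show ?thesis
  proof (rule antisym)
    show "packing_entropy \<phi> K
        \<le> Sup {upper_local_entropy \<phi> \<mu> | \<mu>. \<mu> \<in> borel_prob_measures \<and> measure \<mu> K = 1}"
    \<comment> \<open>Comparing with smaller values \<open>c\<close>, which are finite, treats
      infinite packing entropy along with the finite case.\<close>
    proof (rule dense_le)
      fix c assume c: "c < packing_entropy \<phi> K"
      then obtain s where s: "c = ennreal s" "0 \<le> s"
        by (cases c) auto
      obtain \<mu> where "\<mu> \<in> borel_prob_measures" "measure \<mu> K = 1" "ennreal s \<le> upper_local_entropy \<phi> \<mu>"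
        using c unfolding s(1) by (rule measure_of_large_entropy[OF assms(4) s(2)])
      then show "c \<le> Sup {upper_local_entropy \<phi> \<mu> | \<mu>. \<mu> \<in> borel_prob_measures \<and> measure \<mu> K = 1}"
        unfolding s(1) by (intro Sup_upper2[of "upper_local_entropy \<phi> \<mu>"]) auto
    qed
    show "Sup {upper_local_entropy \<phi> \<mu> | \<mu>. \<mu> \<in> borel_prob_measures \<and> measure \<mu> K = 1}
        \<le> packing_entropy \<phi> K"
      using upper_local_entropy_le_packing_entropy assms(4)
      by (intro Sup_least) (auto simp: compact_imp_closed)
  qed
qed

end
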